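(* Let $t$ be a positive integer. Every simple graph with minimum degree at least $200t$ contains a strong immersion of the complete graph $K_t$.
   Context: All graphs are finite. An immersion of a graph $H$ into a graph $G$ is a one-to-one map $\phi:V(H)\to V(G)$ together with a path $P_{uv}$ in $G$ joining $\phi(u)$ and $\phi(v)$ for each edge $uv\in E(H)$, such that the paths $P_{uv}$, $uv\in E(H)$, are pairwise edge-disjoint. The immersion is strong if every path $P_{uv}$ is internally disjoint from $\phi(V(H))$ (no internal vertex of $P_{uv}$ lies in $\phi(V(H))$). *)

theory Defs
  imports Main
begin

text \<open>An edge is the set of its two ends, so loops and parallel edges cannot occur in
  a simple graph. The empty graph is not excluded here.\<close>

record 'a ugraph =
  verts :: "'a set"
  edges :: "'a set set"

definition simple_graph :: "'a ugraph \<Rightarrow> bool" where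
  "simple_graph G \<longleftrightarrow> finite (verts G) \<and> (\<forall>e \<in> edges G. e \<subseteq> verts G \<and> card e = 2)"

definition degree :: "'a ugraph \<Rightarrow> 'a \<Rightarrow> nat" where
  "degree G v = card {e \<in> edges G. v \<in> e}"

text \<open>Only meaningful when \<open>verts G\<close> is finite and nonempty.\<close>

definition min_degree :: "'a ugraph \<Rightarrow> nat" where
  "min_degree G = Min (degree G ` verts G)"

definition complete_graph :: "nat \<Rightarrow> nat ugraph" where
  "complete_graph t = \<lparr>verts = {..<t}, edges = {e. e \<subseteq> {..<t} \<and> card e = 2}\<rparr>"

text \<open>A path is given by its sequence of vertices.\<close>

definition path_edges :: "'a list \<Rightarrow> 'a set set" where
  "path_edges p = {{p ! i, p ! Suc i} | i. Suc i < length p}"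

definition is_path :: "'a ugraph \<Rightarrow> 'a list \<Rightarrow> bool" where
  "is_path G p \<longleftrightarrow>
     p \<noteq> [] \<and> distinct p \<and> set p \<subseteq> verts G \<and> path_edges p \<subseteq> edges G"

definition internal_verts :: "'a list \<Rightarrow> 'a set" where
  "internal_verts p = set (butlast (tl p))"

text \<open>\<open>P e\<close> is the path assigned to the edge \<open>e\<close> of \<open>H\<close>. As \<open>e\<close> is unordered, the path may be
  listed from either end: for \<open>e = {u, v}\<close> the condition on its ends reads
  \<open>{hd (P e), last (P e)} = {\<phi> u, \<phi> v}\<close>.\<close>

definition immersion :: "'b ugraph \<Rightarrow> 'a ugraph \<Rightarrow> ('b \<Rightarrow> 'a) \<Rightarrow> ('b set \<Rightarrow> 'a list) \<Rightarrow> bool" where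
  "immersion H G \<phi> P \<longleftrightarrow>
     inj_on \<phi> (verts H) \<and> \<phi> ` verts H \<subseteq> verts G \<and>
     (\<forall>e \<in> edges H. is_path G (P e) \<and> {hd (P e), last (P e)} = \<phi> ` e) \<and>
     pairwise (\<lambda>e f. disjnt (path_edges (P e)) (path_edges (P f))) (edges H)"

definition strong_immersion :: "'b ugraph \<Rightarrow> 'a ugraph \<Rightarrow> ('b \<Rightarrow> 'a) \<Rightarrow> ('b set \<Rightarrow> 'a list) \<Rightarrow> bool"
  where
  "strong_immersion H G \<phi> P \<longleftrightarrow>
     immersion H G \<phi> P \<and> (\<forall>e \<in> edges H. disjnt (internal_verts (P e)) (\<phi> ` verts H))"

definition contains_strong_immersion :: "'a ugraph \<Rightarrow> 'b ugraph \<Rightarrow> bool" where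
  "contains_strong_immersion G H \<longleftrightarrow> (\<exists>\<phi> P. strong_immersion H G \<phi> P)"

end

theory Submission
  imports Defs
begin

text \<open>The proof removes vertices from the graph while keeping it simple and its degrees high. To remove
a vertex \<open>w\<close>, pair up its neighbours so that the two members \<open>x\<close>, \<open>y\<close> of a pair are not adjacent, and
replace each path \<open>x w y\<close> by a new edge \<open>x y\<close>. No other degree changes, the new graph is simple, and
a strong immersion of a complete graph in it becomes one in the old graph: \<open>w\<close> is no longer there to
be a branch vertex, so it may be an internal vertex of any number of paths.

Call \<open>t\<close> vertices a clique if they are the branch vertices of a strong immersion of \<open>K\<^sub>t\<close>.
Any \<open>t\<close> vertices that pairwise have \<open>3 t\<close> common neighbours form one, by a greedy choice of paths
of length two (\<open>common_neighbours_clique\<close>). Consequently, if there is no clique, then an even set in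
which every vertex has at least \<open>4 t\<close> non-neighbours has a perfect matching by non-edges
(\<open>perfect_pairing\<close>): if a maximum matching missed two vertices, then the partners of their
non-neighbours would be completely joined to each other, for otherwise there would be an augmenting
path with at most five edges.

So \<open>w\<close> can fail to be removable only because of neighbours that are adjacent to almost all other
neighbours of \<open>w\<close>. Such vertices are removed along with \<open>w\<close>. Starting from one vertex \<open>v\<close>, collect a set
\<open>Q\<close>: for each \<open>w\<close> in it in turn, add a set \<open>R\<close> of neighbours of \<open>w\<close> each of which misses at most
\<open>3 |R|\<close> of the neighbours of \<open>w\<close> outside \<open>Q\<close>. If \<open>R\<close> is as large as possible, then the few remaining
dangerous neighbours can be matched greedily, and the edges made by this are put into the graph at
once (\<open>dominators_and_pairing\<close>, \<open>cluster_step\<close>). The bound \<open>3 |R|\<close> is what makes this work: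
the numbers of missed vertices add up to at most \<open>3 |Q|\<close> along any chain of additions, however long.
Hence all members of \<open>Q\<close> are adjacent to almost all neighbours of the single vertex \<open>v\<close>, so that \<open>t\<close>
of them would form a clique. Therefore \<open>Q\<close> is complete before it has \<open>t\<close> elements.

Now the members of \<open>Q\<close> are removed in the reverse order. If \<open>w\<close> has an odd number of neighbours
outside \<open>Q\<close>, then the parity defect is passed on to a neighbour \<open>p\<close> of \<open>w\<close> in \<open>Q\<close> that was processed before \<open>w\<close>:
some path \<open>u w p y\<close> is replaced by the edge \<open>u y\<close> (\<open>make_even\<close>). Only the last vertex may leave one
vertex \<open>u\<close> whose degree drops by one. This is harmless: the induction on the number of vertices is about graphs in
which all vertices but one have degree at least \<open>200 t\<close> and that one has degree at least \<open>200 t - 1\<close>,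
and the exceptional vertex serves as the start \<open>v\<close> of the next round, in which it is removed.\<close>

section \<open>Routing edges along edge-disjoint walks\<close>

text \<open>A walk from \<open>x\<close> to \<open>y\<close> with edges in \<open>F\<close> and all internal vertices in \<open>L\<close>. Walks instead of paths
make concatenation a rule; the vertices are made distinct only once, at the very end.\<close>

inductive conn :: "'a set set \<Rightarrow> 'a set \<Rightarrow> 'a \<Rightarrow> 'a \<Rightarrow> bool" for F L where
  edge: "{x, y} \<in> F \<Longrightarrow> conn F L x y"
| join: "conn F L x z \<Longrightarrow> z \<in> L \<Longrightarrow> conn F L z y \<Longrightarrow> conn F L x y"

text \<open>A shortest walk repeats no vertex. The end vertices may lie in \<open>L\<close>, but a walk without repetition
does not meet them internally, so it suffices to keep the whole walk inside \<open>L \<union> {x, y}\<close>.\<close>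

lemma conn_imp_path:
  assumes "conn F L x y" and "x \<noteq> y"
  shows "\<exists>p. p \<noteq> [] \<and> distinct p \<and> hd p = x \<and> last p = y \<and> path_edges p \<subseteq> F
    \<and> internal_verts p \<subseteq> L"
proof -
  define walk where "walk p x y \<longleftrightarrow> p \<noteq> [] \<and> hd p = x \<and> last p = y
    \<and> successively (\<lambda>a b. {a, b} \<in> F) p \<and> set p \<subseteq> L \<union> {x, y}" for p x y
  have "\<exists>p. walk p x y" using assms(1)
  proof induction
    case (edge x y)
    then have "walk [x, y] x y" by (simp add: walk_def)
    then show ?case by blast
  next
    case (join x z y)
    then obtain p q where p: "walk p x z" and q: "walk q z y" by blast
    obtain q' where q': "q = z # q'" using q by (cases q) (auto simp: walk_def)
    have "walk (p @ q') x y"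
      using p q \<open>z \<in> L\<close> unfolding walk_def q'
      by (cases q') (auto simp: successively_append_iff)
    then show ?case by blast
  qed
  then obtain p where p: "walk p x y" and least: "\<And>q. walk q x y \<Longrightarrow> length p \<le> length q"
    using exists_least_iff[of "\<lambda>n. \<exists>p. walk p x y \<and> length p = n"] by (metis not_le)
  have "distinct p"
  proof (rule ccontr)
    assume "\<not> distinct p"
    then obtain a b c z where d: "p = a @ [z] @ b @ [z] @ c" using not_distinct_decomp by blast
    have "hd (a @ [z] @ c) = x" "last (a @ [z] @ c) = y"
      using p unfolding walk_def d by (cases a; cases c; simp)+
    moreover have "successively (\<lambda>a b. {a, b} \<in> F) ((a @ [z]) @ (b @ [z] @ c))"
        "successively (\<lambda>a b. {a, b} \<in> F) ((a @ [z] @ b) @ ([z] @ c))"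
      using p unfolding walk_def d by simp_all
    then have "successively (\<lambda>a b. {a, b} \<in> F) (a @ [z] @ c)"
      unfolding successively_append_iff by auto
    moreover have "set (a @ [z] @ c) \<subseteq> L \<union> {x, y}"
      using p unfolding walk_def d by auto
    ultimately have "walk (a @ [z] @ c) x y"
      unfolding walk_def by blast
    from least[OF this] show False by (simp add: d)
  qed
  moreover have "path_edges p \<subseteq> F"
    using p by (auto simp: walk_def path_edges_def successively_conv_nth)
  moreover have "internal_verts p \<subseteq> L"
  proof
    fix z assume z: "z \<in> internal_verts p"
    obtain r where r: "p = x # r" using p by (cases p) (auto simp: walk_def)
    have r': "r \<noteq> []" "last r = y" using p r assms(2) by (auto simp: walk_def split: if_splits)
    have z': "z \<in> set (butlast r)" using z r by (simp add: internal_verts_def)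
    have "distinct (butlast r @ [y])" using \<open>distinct p\<close> r r' by (metis append_butlast_last_id distinct.simps(2))
    then have "z \<noteq> y" using z' by auto
    moreover have "z \<in> set r" using z' by (rule in_set_butlastD)
    moreover have "z \<noteq> x" using \<open>z \<in> set r\<close> \<open>distinct p\<close> r by auto
    ultimately have "z \<noteq> x" "z \<noteq> y" "z \<in> set p" using r by auto
    then show "z \<in> L" using p by (auto simp: walk_def)
  qed
  moreover have "p \<noteq> []" "hd p = x" "last p = y" using p unfolding walk_def by blast+
  ultimately show ?thesis by blast
qed

lemma conn_mono: "conn F L x y \<Longrightarrow> F \<subseteq> F' \<Longrightarrow> L \<subseteq> L' \<Longrightarrow> conn F' L' x y"
proof (induction rule: conn.induct)
  case (edge x y)
  show ?case by (rule conn.edge) (use edge in blast)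
next
  case (join x z y)
  show ?case by (rule conn.join[of _ _ x z y]) (use join in auto)
qed

lemma conn_sym: "conn F L x y \<Longrightarrow> conn F L y x"
proof (induction rule: conn.induct)
  case (edge x y)
  show ?case by (rule conn.edge) (use edge in \<open>simp add: insert_commute\<close>)
next
  case (join x z y)
  show ?case by (rule conn.join[of _ _ y z x]) (use join in simp_all)
qed

text \<open>The edges of \<open>E'\<close> stand for edge-disjoint walks of \<open>E\<close> through \<open>L\<close>. Only edges
have to be kept apart, so routings compose: walks may be substituted for the edges of walks.\<close>

definition routed :: "'a set set \<Rightarrow> 'a set \<Rightarrow> 'a set set \<Rightarrow> bool" where
  "routed E L E' \<longleftrightarrow> (\<exists>P. (\<forall>e\<in>E'. P e \<subseteq> E) \<and> (\<forall>x y. {x, y} \<in> E' \<longrightarrow> conn (P {x, y}) L x y)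
     \<and> (\<forall>e\<in>E'. \<forall>f\<in>E'. e \<noteq> f \<longrightarrow> P e \<inter> P f = {}))"

lemma routedI:
  assumes "\<And>e. e \<in> E' \<Longrightarrow> P e \<subseteq> E" "\<And>x y. {x, y} \<in> E' \<Longrightarrow> conn (P {x, y}) L x y"
    "\<And>e f. e \<in> E' \<Longrightarrow> f \<in> E' \<Longrightarrow> e \<noteq> f \<Longrightarrow> P e \<inter> P f = {}"
  shows "routed E L E'"
proof -
  have "\<forall>e\<in>E'. P e \<subseteq> E" using assms(1) by (rule ballI)
  moreover have "\<forall>x y. {x, y} \<in> E' \<longrightarrow> conn (P {x, y}) L x y" using assms(2) by (intro allI impI)
  moreover have "\<forall>e\<in>E'. \<forall>f\<in>E'. e \<noteq> f \<longrightarrow> P e \<inter> P f = {}" using assms(3) by (intro ballI impI)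
  ultimately show ?thesis unfolding routed_def by (intro exI[of _ P] conjI)
qed

lemma routed_subset: "E' \<subseteq> E \<Longrightarrow> routed E L E'"
proof (rule routedI[of _ "\<lambda>e. {e}"])
  show "conn {{x, y}} L x y" for x y by (rule conn.edge) simp
qed auto

lemma routed_mono: "routed E L E' \<Longrightarrow> L \<subseteq> L' \<Longrightarrow> routed E L' E'"
proof -
  assume r: "routed E L E'" and L: "L \<subseteq> L'"
  obtain P where P: "\<forall>e\<in>E'. P e \<subseteq> E" "\<forall>x y. {x, y} \<in> E' \<longrightarrow> conn (P {x, y}) L x y"
      "\<forall>e\<in>E'. \<forall>f\<in>E'. e \<noteq> f \<longrightarrow> P e \<inter> P f = {}"
    using r unfolding routed_def by (elim exE conjE)
  have "\<forall>x y. {x, y} \<in> E' \<longrightarrow> conn (P {x, y}) L' x y"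
    using P(2) conn_mono[OF _ order_refl L] by simp
  then show ?thesis using P(1,3) unfolding routed_def by (intro exI[of _ P] conjI)
qed

lemma routed_trans:
  assumes "routed E L E'" and "routed E' L E''"
  shows "routed E L E''"
proof -
  obtain P where P: "\<forall>e\<in>E'. P e \<subseteq> E" "\<forall>x y. {x, y} \<in> E' \<longrightarrow> conn (P {x, y}) L x y"
      "\<forall>e\<in>E'. \<forall>f\<in>E'. e \<noteq> f \<longrightarrow> P e \<inter> P f = {}"
    using assms(1) unfolding routed_def by (elim exE conjE)
  obtain Q where Q: "\<forall>e\<in>E''. Q e \<subseteq> E'" "\<forall>x y. {x, y} \<in> E'' \<longrightarrow> conn (Q {x, y}) L x y"
      "\<forall>e\<in>E''. \<forall>f\<in>E''. e \<noteq> f \<longrightarrow> Q e \<inter> Q f = {}"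
    using assms(2) unfolding routed_def by (elim exE conjE)
  have expand: "conn (\<Union> (P ` F)) L x y" if "conn F L x y" "F \<subseteq> E'" for F x y
    using that
  proof (induction rule: conn.induct)
    case (edge x y)
    then have "conn (P {x, y}) L x y" using P(2) by blast
    moreover have "P {x, y} \<subseteq> \<Union> (P ` F)" using edge by blast
    ultimately show ?case by (rule conn_mono) (rule order_refl)
  next
    case (join x z y)
    show ?case by (rule conn.join[of _ _ x z y]) (use join in simp_all)
  qed
  show ?thesis
  proof (rule routedI[of _ "\<lambda>e. \<Union> (P ` Q e)"])
    show "\<Union> (P ` Q e) \<subseteq> E" if "e \<in> E''" for e using P(1) Q(1) that by blast
    show "conn (\<Union> (P ` Q {x, y})) L x y" if "{x, y} \<in> E''" for x y
      using expand Q(1,2) that by simp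
    fix e f assume ef: "e \<in> E''" "f \<in> E''" "e \<noteq> f"
    have "P a \<inter> P b = {}" if "a \<in> Q e" "b \<in> Q f" for a b
    proof -
      have "a \<in> E'" "b \<in> E'" using that Q(1) ef by auto
      moreover have "a \<noteq> b" using that Q(3) ef by blast
      ultimately show ?thesis using P(3) by simp
    qed
    then show "\<Union> (P ` Q e) \<inter> \<Union> (P ` Q f) = {}" by blast
  qed
qed

lemma routed_replace:
  assumes "F \<subseteq> E" and "conn F L x y"
  shows "routed E L (insert {x, y} (E - F))"
proof (rule routedI[of _ "\<lambda>e. if e = {x, y} then F else {e}"])
  fix a b assume "{a, b} \<in> insert {x, y} (E - F)"
  then show "conn (if {a, b} = {x, y} then F else {{a, b}}) L a b"
    using assms(2) conn_sym[OF assms(2)] by (auto simp: doubleton_eq_iff intro: conn.edge)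
qed (use assms(1) in \<open>auto split: if_splits\<close>)

section \<open>Cliques\<close>

definition pairs :: "'a set \<Rightarrow> 'a set set" where
  "pairs T = {e. e \<subseteq> T \<and> card e = 2}"

text \<open>With \<open>L\<close> the complement of \<open>T\<close>, routing all pairs of \<open>T\<close> is a strong immersion of the complete
graph with branch vertices \<open>T\<close>. The set \<open>X\<close> records where branch vertices are allowed: after a vertex
has been used for splitting, it must not become a branch vertex.\<close>

definition has_clique :: "'a set set \<Rightarrow> 'a set \<Rightarrow> nat \<Rightarrow> bool" where
  "has_clique E X t \<longleftrightarrow> (\<exists>T\<subseteq>X. finite T \<and> card T = t \<and> routed E (- T) (pairs T))"

lemma has_clique_mono:
  assumes "has_clique E X t" and "X \<subseteq> Y"
  shows "has_clique E Y t"
proof -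
  obtain T where T: "T \<subseteq> X" "finite T" "card T = t" "routed E (- T) (pairs T)"
    using assms(1) unfolding has_clique_def by (elim exE conjE)
  have "T \<subseteq> Y" using T(1) assms(2) by (rule subset_trans)
  then show ?thesis using T(2-) unfolding has_clique_def by (intro exI[of _ T] conjI)
qed

lemma has_clique_routed:
  assumes "routed E L E'" and "has_clique E' X t" and "X \<inter> L = {}"
  shows "has_clique E X t"
proof -
  obtain T where T: "T \<subseteq> X" "finite T" "card T = t" "routed E' (- T) (pairs T)"
    using assms(2) unfolding has_clique_def by (elim exE conjE)
  have "L \<subseteq> - T" using assms(3) T(1) by blast
  with assms(1) have "routed E (- T) E'" by (rule routed_mono)
  then have "routed E (- T) (pairs T)" using T(4) by (rule routed_trans)
  then show ?thesis using T unfolding has_clique_def by (intro exI[of _ T] conjI)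
qed

lemma contains_complete_graph:
  assumes sg: "simple_graph G" and cl: "has_clique (edges G) (verts G) t"
  shows "contains_strong_immersion G (complete_graph t)"
proof -
  obtain T where T: "T \<subseteq> verts G" "finite T" "card T = t"
    and rt: "routed (edges G) (- T) (pairs T)"
    using cl unfolding has_clique_def by (elim exE conjE)
  obtain P where P: "\<forall>e\<in>pairs T. P e \<subseteq> edges G" "\<forall>x y. {x, y} \<in> pairs T \<longrightarrow> conn (P {x, y}) (- T) x y"
      "\<forall>e\<in>pairs T. \<forall>f\<in>pairs T. e \<noteq> f \<longrightarrow> P e \<inter> P f = {}"
    using rt unfolding routed_def by (elim exE conjE)
  obtain \<phi> where \<phi>: "bij_betw \<phi> {..<t} T"
    using T ex_bij_betw_nat_finite by (metis lessThan_atLeast0)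
  have inj: "inj_on \<phi> {..<t}" and im: "\<phi> ` {..<t} = T" using \<phi> by (auto simp: bij_betw_def)
  have ip: "\<phi> ` e \<in> pairs T" if "e \<in> edges (complete_graph t)" for e
    using that im inj by (auto simp: pairs_def complete_graph_def card_image inj_on_subset)
  have "\<exists>p. is_path G p \<and> {hd p, last p} = f \<and> path_edges p \<subseteq> P f \<and> internal_verts p \<subseteq> - T"
    if f: "f \<in> pairs T" for f
  proof -
    obtain x y where xy: "f = {x, y}" "x \<noteq> y" using f by (auto simp: pairs_def card_2_iff)
    obtain p where p: "p \<noteq> []" "distinct p" "hd p = x" "last p = y" "path_edges p \<subseteq> P f"
        "internal_verts p \<subseteq> - T"
      using conn_imp_path[of "P f" "- T" x y] P(2) f xy by blast
    have pe: "path_edges p \<subseteq> edges G" using p(5) P(1) f by blast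
    have "set p \<subseteq> verts G"
    proof
      fix z assume "z \<in> set p"
      then obtain i where i: "i < length p" "z = p ! i" by (auto simp: in_set_conv_nth)
      have len: "length p > 1" using p(1,3,4) xy(2)
        by (cases p) (auto split: if_splits)
      have "\<exists>e\<in>path_edges p. z \<in> e"
      proof (cases "Suc i < length p")
        case True
        then show ?thesis using i by (auto simp: path_edges_def)
      next
        case False
        then have "Suc (i - 1) < length p" "z = p ! Suc (i - 1)" using i len by auto
        then show ?thesis unfolding path_edges_def by blast
      qed
      then show "z \<in> verts G" using pe sg by (auto simp: simple_graph_def)
    qed
    then show ?thesis using p pe xy unfolding is_path_def by blast
  qed
  then obtain p where p: "\<And>f. f \<in> pairs T \<Longrightarrow> is_path G (p f) \<and> {hd (p f), last (p f)} = f
      \<and> path_edges (p f) \<subseteq> P f \<and> internal_verts (p f) \<subseteq> - T"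
    by metis
  have vs: "verts (complete_graph t) = {..<t}" by (simp add: complete_graph_def)
  have "pairwise (\<lambda>e f. disjnt (path_edges (p (\<phi> ` e))) (path_edges (p (\<phi> ` f))))
      (edges (complete_graph t))"
  proof (rule pairwiseI)
    fix e f assume ef: "e \<in> edges (complete_graph t)" "f \<in> edges (complete_graph t)" "e \<noteq> f"
    then have "e \<subseteq> {..<t}" "f \<subseteq> {..<t}" by (auto simp: complete_graph_def)
    then have "\<phi> ` e \<noteq> \<phi> ` f" using inj ef(3) by (meson inj_on_image_eq_iff)
    then have "disjnt (P (\<phi> ` e)) (P (\<phi> ` f))" using P(3) ip ef by (simp add: disjnt_def)
    then show "disjnt (path_edges (p (\<phi> ` e))) (path_edges (p (\<phi> ` f)))"
      using p[OF ip[OF ef(1)]] p[OF ip[OF ef(2)]] by (meson disjnt_subset1 disjnt_subset2)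
  qed
  then have "strong_immersion (complete_graph t) G \<phi> (\<lambda>e. p (\<phi> ` e))"
    unfolding strong_immersion_def immersion_def vs
    using inj im T(1) p[OF ip] by (simp add: disjnt_def) blast
  then show ?thesis unfolding contains_strong_immersion_def by blast
qed

definition nb :: "'a set set \<Rightarrow> 'a \<Rightarrow> 'a set" where
  "nb E x = {y. {x, y} \<in> E}"

lemma nb_sym: "y \<in> nb E x \<longleftrightarrow> x \<in> nb E y"
  by (simp add: nb_def insert_commute)

text \<open>Greedy list colouring of a conflict graph: an element can be coloured last because its conflicts
block fewer colours than its list has.\<close>

lemma greedy_choice:
  assumes "finite S" and sym: "\<And>e f. conf e f \<Longrightarrow> conf f e"
    and "\<And>e. e \<in> S \<Longrightarrow> finite (A e)"
    and "\<And>e. e \<in> S \<Longrightarrow> card {f \<in> S. f \<noteq> e \<and> conf e f} < card (A e)"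
  shows "\<exists>c. (\<forall>e\<in>S. c e \<in> A e) \<and> (\<forall>e\<in>S. \<forall>f\<in>S. e \<noteq> f \<and> conf e f \<longrightarrow> c e \<noteq> c f)"
  using assms(1,3,4)
proof (induction S rule: finite_induct)
  case (insert x S)
  have "card {f \<in> S. f \<noteq> e \<and> conf e f} < card (A e)" if "e \<in> S" for e
  proof -
    have "card {f \<in> S. f \<noteq> e \<and> conf e f} \<le> card {f \<in> insert x S. f \<noteq> e \<and> conf e f}"
      using insert.hyps(1) by (intro card_mono) auto
    then show ?thesis using insert.prems(2)[of e] that by simp
  qed
  then obtain c where c: "\<forall>e\<in>S. c e \<in> A e" "\<forall>e\<in>S. \<forall>f\<in>S. e \<noteq> f \<and> conf e f \<longrightarrow> c e \<noteq> c f"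
    using insert.IH insert.prems(1) by auto
  have "{f \<in> insert x S. f \<noteq> x \<and> conf x f} = {f \<in> S. conf x f}" using insert.hyps(2) by auto
  then have "card {f \<in> S. conf x f} < card (A x)" using insert.prems(2)[of x] by simp
  then have "card (c ` {f \<in> S. conf x f}) < card (A x)"
    using card_image_le[of "{f \<in> S. conf x f}" c] insert.hyps(1) by simp
  then obtain a where a: "a \<in> A x" "a \<notin> c ` {f \<in> S. conf x f}"
    using card_mono[of "c ` {f \<in> S. conf x f}" "A x"] insert.hyps(1) by fastforce
  show ?case
  proof (intro exI[of _ "c(x := a)"] conjI ballI impI)
    fix e f assume "e \<in> insert x S" "f \<in> insert x S" "e \<noteq> f \<and> conf e f"
    then show "(c(x := a)) e \<noteq> (c(x := a)) f"
      using a c insert.hyps(2) sym[of e f] by auto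
  qed (use a c in auto)
qed simp

text \<open>Join each pair of \<open>T\<close> by a path of length two. Such paths stay edge-disjoint as long as two pairs with
a common vertex get different middle vertices. At least \<open>2 t\<close> of the common neighbours of a pair lie
outside \<open>T\<close>, and fewer than \<open>2 t\<close> other pairs meet it.\<close>

lemma common_neighbours_clique:
  assumes "finite T" and "card T = t"
    and common: "\<And>x y. x \<in> T \<Longrightarrow> y \<in> T \<Longrightarrow> x \<noteq> y \<Longrightarrow> 3 * t \<le> card (nb E x \<inter> nb E y)"
  shows "has_clique E T t"
proof -
  define A where "A e = {c. c \<notin> T \<and> (\<forall>x\<in>e. c \<in> nb E x)}" for e
  have fin: "finite (pairs T)" using assms(1) by (simp add: pairs_def)
  have A: "finite (A e)" "card {f \<in> pairs T. f \<noteq> e \<and> e \<inter> f \<noteq> {}} < card (A e)"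
    if e: "e \<in> pairs T" for e
  proof -
    obtain x y where xy: "e = {x, y}" "x \<noteq> y" "x \<in> T" "y \<in> T"
      using e by (auto simp: pairs_def card_2_iff)
    have t: "t > 0" using assms xy(3) by (auto simp: card_gt_0_iff)
    have big: "3 * t \<le> card (nb E x \<inter> nb E y)" using common xy by blast
    have Ae: "A e = nb E x \<inter> nb E y - T" by (auto simp: A_def xy)
    have "finite (nb E x \<inter> nb E y)" using big t by (intro card_ge_0_finite) simp
    then show "finite (A e)" by (simp add: Ae)
    have "card (nb E x \<inter> nb E y) - card T \<le> card (A e)"
      unfolding Ae using assms(1) by (rule diff_card_le_card_Diff)
    then have Age: "2 * t \<le> card (A e)" using big assms(2) by simp
    have "{f \<in> pairs T. f \<noteq> e \<and> e \<inter> f \<noteq> {}}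
        \<subseteq> (\<lambda>z. {x, z}) ` (T - {x}) \<union> (\<lambda>z. {y, z}) ` (T - {y})"
      by (auto simp: pairs_def card_2_iff xy doubleton_eq_iff image_iff)
    then have "card {f \<in> pairs T. f \<noteq> e \<and> e \<inter> f \<noteq> {}}
        \<le> card ((\<lambda>z. {x, z}) ` (T - {x}) \<union> (\<lambda>z. {y, z}) ` (T - {y}))"
      using assms(1) by (intro card_mono) auto
    also have "\<dots> \<le> card ((\<lambda>z. {x, z}) ` (T - {x})) + card ((\<lambda>z. {y, z}) ` (T - {y}))"
      by (rule card_Un_le)
    also have "\<dots> \<le> card (T - {x}) + card (T - {y})"
      using assms(1) by (intro add_mono card_image_le) auto
    also have "\<dots> < 2 * t" using assms xy t by simp
    finally show "card {f \<in> pairs T. f \<noteq> e \<and> e \<inter> f \<noteq> {}} < card (A e)" using Age by simp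
  qed
  have "\<exists>c. (\<forall>e\<in>pairs T. c e \<in> A e)
      \<and> (\<forall>e\<in>pairs T. \<forall>f\<in>pairs T. e \<noteq> f \<and> e \<inter> f \<noteq> {} \<longrightarrow> c e \<noteq> c f)"
    by (rule greedy_choice[OF fin]) (simp_all add: A Int_commute)
  then obtain c where c0: "\<forall>e\<in>pairs T. c e \<in> A e"
      "\<forall>e\<in>pairs T. \<forall>f\<in>pairs T. e \<noteq> f \<and> e \<inter> f \<noteq> {} \<longrightarrow> c e \<noteq> c f"
    by (elim exE conjE)
  have c: "\<And>e. e \<in> pairs T \<Longrightarrow> c e \<in> A e"
      "\<And>e f. e \<in> pairs T \<Longrightarrow> f \<in> pairs T \<Longrightarrow> e \<noteq> f \<Longrightarrow> e \<inter> f \<noteq> {} \<Longrightarrow> c e \<noteq> c f"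
    using c0 by simp_all
  have "routed E (- T) (pairs T)"
  proof (rule routedI[of _ "\<lambda>e. (\<lambda>x. {x, c e}) ` e"])
    show "(\<lambda>x. {x, c e}) ` e \<subseteq> E" if "e \<in> pairs T" for e
      using c(1)[OF that] by (auto simp: A_def nb_def)
  next
    fix x y assume xy: "{x, y} \<in> pairs T"
    have "c {x, y} \<in> - T" using c(1)[OF xy] by (simp add: A_def)
    then show "conn ((\<lambda>z. {z, c {x, y}}) ` {x, y}) (- T) x y"
      by (intro conn.join[of _ _ x "c {x, y}" y] conn.edge) (auto simp: insert_commute)
  next
    fix e f assume ef: "e \<in> pairs T" "f \<in> pairs T" "e \<noteq> f"
    have "c e \<notin> T" "c f \<notin> T" "e \<subseteq> T" "f \<subseteq> T"
      using ef c(1) by (auto simp: A_def pairs_def)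
    then have "e \<inter> f \<noteq> {} \<and> c e = c f"
      if "x \<in> e" "y \<in> f" "{x, c e} = {y, c f}" for x y
      using that by (auto simp: doubleton_eq_iff)
    then show "(\<lambda>x. {x, c e}) ` e \<inter> (\<lambda>x. {x, c f}) ` f = {}"
      using c(2)[OF ef] by blast
  qed
  then show ?thesis using assms(1,2) unfolding has_clique_def by (intro exI[of _ T] conjI) auto
qed

text \<open>The form in which cliques are found below: vertices that see almost all of one large set \<open>N\<close> have
many common neighbours in it.\<close>

lemma almost_complete_clique:
  assumes "finite N" and "finite T" and "T \<subseteq> X" and "t \<le> card T"
    and miss: "\<And>x. x \<in> T \<Longrightarrow> card (N - nb E x) \<le> m" and "2 * m + 3 * t \<le> card N"
    and fin: "\<And>x. finite (nb E x)"
  shows "has_clique E X t"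
proof -
  obtain S where S: "S \<subseteq> T" "card S = t" "finite S"
    using obtain_subset_with_card_n[OF assms(4)] by metis
  have "has_clique E S t"
  proof (rule common_neighbours_clique[OF S(3,2)])
    fix x y assume xy: "x \<in> S" "y \<in> S"
    have "card N \<le> card ((nb E x \<inter> nb E y) \<union> ((N - nb E x) \<union> (N - nb E y)))"
      using assms(1) fin by (intro card_mono) auto
    also have "\<dots> \<le> card (nb E x \<inter> nb E y) + (card (N - nb E x) + card (N - nb E y))"
      by (meson add_left_mono card_Un_le le_trans)
    also have "\<dots> \<le> card (nb E x \<inter> nb E y) + 2 * m"
    proof -
      have "x \<in> T" "y \<in> T" using xy S(1) by auto
      then show ?thesis using miss[of x] miss[of y] by simp
    qed
    finally show "3 * t \<le> card (nb E x \<inter> nb E y)" using assms(6) by simp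
  qed
  moreover have "S \<subseteq> X" using S(1) assms(3) by blast
  ultimately show ?thesis by (rule has_clique_mono)
qed

section \<open>Matchings by non-edges\<close>

definition moved :: "('a \<Rightarrow> 'a) \<Rightarrow> 'a set" where
  "moved f = {x. f x \<noteq> x}"

text \<open>A matching by non-edges inside \<open>N\<close>, as an involution of the whole type: matched vertices are
exchanged, and all others, in particular those outside \<open>N\<close>, are fixed points.\<close>

definition pairing :: "'a set set \<Rightarrow> 'a set \<Rightarrow> ('a \<Rightarrow> 'a) \<Rightarrow> bool" where
  "pairing E N f \<longleftrightarrow> (\<forall>x. f (f x) = x) \<and> (\<forall>x. f x \<noteq> x \<longrightarrow> x \<in> N \<and> {x, f x} \<notin> E)"

lemma pairing_moved: "pairing E N f \<Longrightarrow> moved f \<subseteq> N"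
  by (auto simp: pairing_def moved_def)

lemma pairing_add:
  assumes "pairing E N f" "a \<in> N" "b \<in> N" "a \<noteq> b" "a \<notin> moved f" "b \<notin> moved f" "b \<notin> nb E a"
  shows "pairing E N (f(a := b, b := a))" "moved (f(a := b, b := a)) = insert a (insert b (moved f))"
proof -
  have ff: "f (f x) = x" and fN: "f x \<noteq> x \<Longrightarrow> x \<in> N \<and> {x, f x} \<notin> E" for x
    using assms(1) by (simp_all add: pairing_def)
  have fab: "f a = a" "f b = b" using assms(5,6) by (simp_all add: moved_def)
  have ab: "{a, b} \<notin> E" "{b, a} \<notin> E" using assms(7) by (simp_all add: nb_def insert_commute)
  have "f x \<noteq> a" "f x \<noteq> b" if "x \<noteq> a" "x \<noteq> b" for x
    using ff[of x] fab that by auto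
  then show "pairing E N (f(a := b, b := a))"
    using assms(2-4) ff fN ab unfolding pairing_def by simp
  show "moved (f(a := b, b := a)) = insert a (insert b (moved f))"
    using assms by (auto simp: moved_def)
qed

lemma pairing_remove:
  assumes "pairing E N f"
  shows "pairing E N (f(x := x, f x := f x))" "moved (f(x := x, f x := f x)) = moved f - {x, f x}"
proof -
  have ff: "f (f y) = y" and fN: "f y \<noteq> y \<Longrightarrow> y \<in> N \<and> {y, f y} \<notin> E" for y
    using assms by (simp_all add: pairing_def)
  have "f y \<noteq> x" "f y \<noteq> f x" if "y \<noteq> x" "y \<noteq> f x" for y
    using ff[of y] ff[of x] that by auto
  then show "pairing E N (f(x := x, f x := f x))"
    using ff fN unfolding pairing_def by simp
  show "moved (f(x := x, f x := f x)) = moved f - {x, f x}"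
    by (auto simp: moved_def)
qed

lemma even_card_moved: "finite (moved f) \<Longrightarrow> pairing E N f \<Longrightarrow> even (card (moved f))"
proof (induction "card (moved f)" arbitrary: f rule: less_induct)
  case less
  show ?case
  proof (cases "moved f = {}")
    case False
    then obtain x where x: "f x \<noteq> x" by (auto simp: moved_def)
    let ?g = "f(x := x, f x := f x)"
    note g = pairing_remove[OF less.prems(2), of x]
    have "f (f x) = x" using less.prems(2) by (auto simp: pairing_def)
    then have sub: "{x, f x} \<subseteq> moved f" using x by (auto simp: moved_def)
    have c: "card (moved f) = card (moved ?g) + 2"
      using card_Diff_subset[of "{x, f x}" "moved f"] card_mono[OF less.prems(1) sub] sub x
      unfolding g(2) by simp
    have "even (card (moved ?g))"
      by (rule less.hyps) (use c g less.prems in auto)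
    then show ?thesis using c by simp
  qed simp
qed

text \<open>Augmenting paths, starting with non-edges \<open>u x\<close> and \<open>v z\<close> at two unmatched vertices. By maximality, \<open>x\<close>
and \<open>z\<close> are matched. If \<open>z\<close> is the
partner of \<open>x\<close>, then \<open>u x z v\<close> is augmenting; otherwise \<open>u x (f x) (f z) z v\<close> is, unless
\<open>f x\<close> and \<open>f z\<close> are adjacent.\<close>

lemma max_pairing_exchange:
  assumes "finite N" and f: "pairing E N f"
    and max: "\<And>g. pairing E N g \<Longrightarrow> card (moved g) \<le> card (moved f)"
    and u: "u \<in> N - moved f" "v \<in> N - moved f" "u \<noteq> v"
    and x: "x \<in> N - nb E u - {u}" and z: "z \<in> N - nb E v - {v}"
    and ne: "f x \<noteq> f z"
  shows "f z \<in> nb E (f x)"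
proof (rule ccontr)
  assume no: "f z \<notin> nb E (f x)"
  have ff: "f (f y) = y" for y using f by (simp add: pairing_def)
  have mN: "moved g \<subseteq> N" "finite (moved g)" if "pairing E N g" for g
    using pairing_moved[OF that] assms(1) finite_subset by blast+
  have bigger: "False" if "pairing E N g" "moved f \<subset> moved g" for g
    using max[OF that(1)] psubset_card_mono[OF mN(2)[OF that(1)] that(2)] by simp
  have moved_nn: "y \<in> moved f" if "a \<in> N - moved f" "y \<in> N - nb E a - {a}" for a y
  proof (rule ccontr)
    assume y: "y \<notin> moved f"
    show False
      by (rule bigger, rule pairing_add(1)[OF f, of a y], insert pairing_add(2)[OF f, of a y] that y) auto
  qed
  have mx: "x \<in> moved f" "z \<in> moved f" using moved_nn u x z by blast+
  then have mfx: "f x \<in> moved f" "f z \<in> moved f" using ff by (auto simp: moved_def)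
  have distinct: "x \<noteq> f x" "z \<noteq> f z" "u \<notin> {x, z, f x, f z}" "v \<notin> {x, z, f x, f z}"
    using mx mfx u by (auto simp: moved_def)
  have inN: "f x \<in> N" "f z \<in> N" using mfx mN[OF f] by blast+
  define g1 where "g1 = f(x := x, f x := f x)"
  have g1: "pairing E N g1" "moved g1 = moved f - {x, f x}"
    using pairing_remove[OF f, of x] by (simp_all add: g1_def)
  \<comment> \<open>The matching edges on the augmenting path are dissolved one by one, then the new ones are added.\<close>
  show False
  proof (cases "z = f x")
    case True
    define h where "h = g1(u := x, x := u)"
    have h: "pairing E N h" "moved h = insert u (insert x (moved f - {x, f x}))"
      using pairing_add[OF g1(1), of u x] x u distinct g1(2) unfolding h_def by auto
    have "pairing E N (h(v := z, z := v))" "moved (h(v := z, z := v)) = insert v (insert z (moved h))"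
      using pairing_add[OF h(1), of v z] z u distinct h(2) True by auto
    then show False using bigger h(2) True u mx by blast
  next
    case False
    have fz: "z \<noteq> x" "f z \<noteq> x" using ne False ff by metis+
    have g1z: "g1 z = f z" using fz False by (simp add: g1_def)
    define g2 where "g2 = g1(z := z, f z := f z)"
    have g2: "pairing E N g2" "moved g2 = moved f - {x, f x, z, f z}"
      using pairing_remove[OF g1(1), of z] g1(2) g1z unfolding g2_def by auto
    define g3 where "g3 = g2(u := x, x := u)"
    have g3: "pairing E N g3" "moved g3 = insert u (insert x (moved f - {x, f x, z, f z}))"
      using pairing_add[OF g2(1), of u x] x u distinct g2(2) unfolding g3_def by auto
    define g4 where "g4 = g3(v := z, z := v)"
    have g4: "pairing E N g4"
        "moved g4 = insert v (insert z (insert u (insert x (moved f - {x, f x, z, f z}))))"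
      using pairing_add[OF g3(1), of v z] z u distinct fz g3(2) unfolding g4_def by auto
    define g5 where "g5 = g4(f x := f z, f z := f x)"
    have g5: "pairing E N g5" "moved g5 = insert (f x) (insert (f z) (moved g4))"
      using pairing_add[OF g4(1), of "f x" "f z"] distinct fz ne False inN no g4(2) unfolding g5_def by auto
    show False using bigger[OF g5(1)] g5(2) g4(2) u by blast
  qed
qed

text \<open>If a maximum matching left two vertices unmatched, then the partners of the non-neighbours
of one would be joined to all partners of the non-neighbours of the other. Either set has at least
\<open>4 t\<close> elements, so that \<open>t\<close> of the former have \<open>3 t\<close> common neighbours among the latter.
So at most one vertex is unmatched, and none by parity.\<close>

lemma perfect_pairing:
  assumes "finite N" and "even (card N)" and fin: "\<And>x. finite (nb E x)"
    and miss: "\<And>x. x \<in> N \<Longrightarrow> 4 * t + 1 \<le> card (N - nb E x)"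
    and no: "\<not> has_clique E N t"
  shows "\<exists>f. pairing E N f \<and> moved f = N"
proof -
  have "pairing E N id" by (simp add: pairing_def)
  moreover have "card (moved g) < Suc (card N)" if "pairing E N g" for g
    using card_mono[OF assms(1) pairing_moved[OF that]] by simp
  ultimately have "\<exists>f. pairing E N f \<and> (\<forall>g. pairing E N g \<longrightarrow> card (moved g) \<le> card (moved f))"
    by (intro ex_has_greatest_nat[of "pairing E N" id _ "Suc (card N)"]) simp_all
  then obtain f where f: "pairing E N f"
      and max': "\<forall>g. pairing E N g \<longrightarrow> card (moved g) \<le> card (moved f)"
    by (elim exE conjE)
  have max: "\<And>g. pairing E N g \<Longrightarrow> card (moved g) \<le> card (moved f)" using max' by simp
  have mN: "moved f \<subseteq> N" using f by (rule pairing_moved)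
  have ff: "f (f x) = x" for x using f by (simp add: pairing_def)
  have inj: "inj f" by (rule inj_on_inverseI[of _ f]) (rule ff)
  have "u = v" if u: "u \<in> N - moved f" and v: "v \<in> N - moved f" for u v
  proof (rule ccontr)
    assume ne: "u \<noteq> v"
    let ?A = "f ` (N - nb E u - {u})" and ?B = "f ` (N - nb E v - {v})"
    have cA: "4 * t \<le> card (f ` (N - nb E w - {w}))" if "w \<in> N" for w
    proof -
      have "card (f ` (N - nb E w - {w})) = card (N - nb E w - {w})"
        using inj_on_subset[OF inj] by (intro card_image) blast
      moreover have "card (N - nb E w) - 1 \<le> card (N - nb E w - {w})"
        by (simp add: card_Diff_singleton_if)
      ultimately show ?thesis using miss[OF that] by linarith
    qed
    have cA: "4 * t \<le> card ?A" "4 * t \<le> card ?B" using cA u v by blast+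
    have fB: "finite ?A" "finite ?B" using assms(1) by simp_all
    obtain S where S: "S \<subseteq> ?A" "card S = t" "finite S"
      using obtain_subset_with_card_n[of t ?A] cA by auto
    have full: "?B - S \<subseteq> nb E s" if "s \<in> S" for s
    proof
      fix b assume b: "b \<in> ?B - S"
      then have "s \<noteq> b" using that by blast
      then show "b \<in> nb E s"
        using b that S(1) max_pairing_exchange[OF assms(1) f max u v ne] by blast
    qed
    have "has_clique E S t"
    proof (rule common_neighbours_clique[OF S(3,2)])
      fix x y assume "x \<in> S" "y \<in> S"
      then have "card (?B - S) \<le> card (nb E x \<inter> nb E y)"
        using full fin by (intro card_mono) auto
      then show "3 * t \<le> card (nb E x \<inter> nb E y)"
        using diff_card_le_card_Diff[OF S(3), of ?B] S(2) cA by simp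
    qed
    moreover have "S \<subseteq> N"
    proof -
      have "f x \<in> N" if "x \<in> N" for x
        using f that mN unfolding pairing_def moved_def by (metis)
      then show ?thesis using S(1) by blast
    qed
    ultimately show False using no has_clique_mono by blast
  qed
  then have "card (N - moved f) \<le> 1" using assms(1)
    by (metis card_le_Suc0_iff_eq finite_Diff One_nat_def)
  moreover have "card N = card (moved f) + card (N - moved f)"
    using mN assms(1) by (metis card_Diff_subset card_mono finite_subset le_add_diff_inverse)
  moreover have "even (card (moved f))"
    using even_card_moved[OF _ f] mN assms(1) finite_subset by blast
  ultimately have "card (N - moved f) = 0" using assms(2)
    by (metis One_nat_def dvd_add_right_iff le_Suc_eq le_zero_eq odd_one)
  then show ?thesis using f mN assms(1) by auto
qed

text \<open>The assumption orders \<open>Y\<close> such that the \<open>k\<close>-th vertex has at least \<open>2 k\<close> non-neighbours, where it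
counts itself. When its turn comes, at most \<open>2 (k - 1)\<close> vertices are used up.\<close>

lemma greedy_pairing:
  assumes "finite B" and "finite Y" and "Y \<subseteq> B"
    and "\<And>Z. Z \<subseteq> Y \<Longrightarrow> Z \<noteq> {} \<Longrightarrow> \<exists>y\<in>Z. 2 * card Z \<le> card (B - nb E y)"
  shows "\<exists>f. pairing E B f \<and> Y \<subseteq> moved f \<and> card (moved f) \<le> 2 * card Y"
  using assms(2-4)
proof (induction "card Y" arbitrary: Y)
  case 0
  then show ?case by (intro exI[of _ "\<lambda>x. x"]) (simp add: pairing_def moved_def)
next
  case (Suc n)
  then have "Y \<noteq> {}" by auto
  then obtain y where y: "y \<in> Y" "2 * card Y \<le> card (B - nb E y)" using Suc.prems(3) by blast
  have n: "n = card (Y - {y})" using Suc y by simp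
  have "\<exists>f. pairing E B f \<and> Y - {y} \<subseteq> moved f \<and> card (moved f) \<le> 2 * card (Y - {y})"
    by (rule Suc.hyps(1)[OF n]) (use Suc.prems in blast)+
  then obtain f where f: "pairing E B f" "Y - {y} \<subseteq> moved f" "card (moved f) \<le> 2 * n"
    using n by auto
  have fm: "finite (moved f)" using pairing_moved[OF f(1)] assms(1) finite_subset by blast
  show ?case
  proof (cases "y \<in> moved f")
    case True
    then show ?thesis using f Suc.hyps(2) by (intro exI[of _ f]) auto
  next
    case False
    have "card (insert y (moved f)) < card (B - nb E y)"
      using y(2) f(3) Suc.hyps(2) fm False by simp
    then obtain b where b: "b \<in> B - nb E y" "b \<notin> insert y (moved f)"
      using card_mono[of "insert y (moved f)" "B - nb E y"] fm by fastforce
    have g: "pairing E B (f(y := b, b := y))"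
        "moved (f(y := b, b := y)) = insert y (insert b (moved f))"
      using pairing_add[OF f(1), of y b] b y Suc.prems False by auto
    moreover have "y \<notin> insert b (moved f)" "b \<notin> moved f" using b False by auto
    then have "card (insert y (insert b (moved f))) \<le> 2 * card Y"
      using f(3) Suc.hyps(2) fm by simp
    ultimately show ?thesis using f(2) by (intro exI[of _ "f(y := b, b := y)"]) auto
  qed
qed

section \<open>Splitting the edges at a vertex\<close>

definition graph_on :: "'a set \<Rightarrow> 'a set set \<Rightarrow> bool" where
  "graph_on V E \<longleftrightarrow> finite V \<and> (\<forall>e\<in>E. e \<subseteq> V \<and> card e = 2)"

lemma graph_on_nb:
  assumes "graph_on V E"
  shows "nb E x \<subseteq> V" "finite (nb E x)" "x \<notin> nb E x"
proof -
  show sub: "nb E x \<subseteq> V" using assms by (auto simp: graph_on_def nb_def)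
  show "finite (nb E x)" using sub assms finite_subset by (auto simp: graph_on_def)
  show "x \<notin> nb E x" using assms by (auto simp: graph_on_def nb_def)
qed

definition split_at :: "'a set set \<Rightarrow> 'a \<Rightarrow> ('a \<Rightarrow> 'a) \<Rightarrow> 'a set set" where
  "split_at E w f = (E - (\<lambda>x. {w, x}) ` moved f) \<union> (\<lambda>x. {x, f x}) ` moved f"

context
  fixes V :: "'a set" and E :: "'a set set" and N :: "'a set" and f :: "'a \<Rightarrow> 'a" and w :: 'a
  assumes g: "graph_on V E" and f: "pairing E N f" and N: "N \<subseteq> nb E w"
begin

lemma split_ff: "f (f x) = x"
  using f by (simp add: pairing_def)

lemma split_moved: "x \<in> moved f \<Longrightarrow> x \<in> nb E w \<and> f x \<in> nb E w \<and> f x \<in> moved f \<and> x \<noteq> w \<and> f x \<noteq> x \<and> f x \<noteq> w \<and> f x \<notin> nb E x"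
proof -
  assume x: "x \<in> moved f"
  then have fx: "f x \<in> moved f" using split_ff by (auto simp: moved_def)
  have "x \<in> nb E w" "f x \<in> nb E w" using x fx pairing_moved[OF f] N by blast+
  moreover have "f x \<notin> nb E x" using f x by (auto simp: pairing_def moved_def nb_def)
  moreover have "w \<notin> nb E w" using graph_on_nb(3)[OF g] .
  ultimately show ?thesis using x fx by (auto simp: moved_def)
qed

lemma split_nb:
  assumes "x \<noteq> w"
  shows "nb (split_at E w f) x = (if f x = x then nb E x else insert (f x) (nb E x - {w}))"
proof -
  have old: "{x, y} \<in> (\<lambda>z. {w, z}) ` moved f \<longleftrightarrow> y = w \<and> x \<in> moved f" for y
    using assms by (auto simp: doubleton_eq_iff)
  have new: "{x, y} \<in> (\<lambda>z. {z, f z}) ` moved f \<longleftrightarrow> y = f x \<and> x \<in> moved f" for y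
  proof
    assume "{x, y} \<in> (\<lambda>z. {z, f z}) ` moved f"
    then obtain z where z: "z \<in> moved f" "{x, y} = {z, f z}" by blast
    then show "y = f x \<and> x \<in> moved f"
      using split_ff[of z] split_moved[OF z(1)] by (auto simp: doubleton_eq_iff)
  qed auto
  have "y \<in> nb (split_at E w f) x \<longleftrightarrow>
      y \<in> nb E x \<and> \<not> (y = w \<and> x \<in> moved f) \<or> y = f x \<and> x \<in> moved f" for y
    using old[of y] new[of y] by (auto simp: nb_def split_at_def)
  then show ?thesis by (auto simp: moved_def)
qed

lemma split_nb_centre: "nb (split_at E w f) w = nb E w - moved f"
proof -
  have old: "{w, y} \<in> (\<lambda>z. {w, z}) ` moved f \<longleftrightarrow> y \<in> moved f" for y
    by (auto simp: doubleton_eq_iff image_iff)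
  have new: "{w, y} \<notin> (\<lambda>z. {z, f z}) ` moved f" for y
    using split_moved by (auto simp: doubleton_eq_iff)
  show ?thesis using old new by (auto simp: nb_def split_at_def)
qed

lemma split_degree:
  assumes "x \<noteq> w"
  shows "card (nb (split_at E w f) x) = card (nb E x)"
proof (cases "f x = x")
  case False
  then have "x \<in> moved f" by (simp add: moved_def)
  note m = split_moved[OF this]
  have "w \<in> nb E x" using m nb_sym[of w E x] by simp
  then have "card (insert (f x) (nb E x - {w})) = card (nb E x)"
    using graph_on_nb(2)[OF g, of x] m card_Suc_Diff1[of "nb E x" w] by simp
  then show ?thesis using False by (simp add: split_nb[OF assms])
qed (simp add: split_nb[OF assms])

lemma split_graph: "graph_on V (split_at E w f)"
proof -
  have "{x, f x} \<subseteq> V \<and> card {x, f x} = 2" if "x \<in> moved f" for x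
    using split_moved[OF that] graph_on_nb(1)[OF g, of w] by (auto simp: card_2_iff)
  then show ?thesis using g by (auto simp: graph_on_def split_at_def)
qed

lemma split_routed: "routed E {w} (split_at E w f)"
proof -
  define New where "New = (\<lambda>x. {x, f x}) ` moved f"
  have form: "x \<in> moved f \<and> e = {x, f x}" if e: "e \<in> New" "x \<in> e" for e x
  proof -
    obtain z where z: "z \<in> moved f" "e = {z, f z}" using e(1) unfolding New_def by auto
    then have "x = z \<or> x = f z" using e(2) by simp
    then show ?thesis using z split_moved[OF z(1)] split_ff[of z] by auto
  qed
  have same: "e = e'" if "e \<in> New" "e' \<in> New" "x \<in> e" "x \<in> e'" for e e' x
    using form[OF that(1,3)] form[OF that(2,4)] by simp
  have m: "x \<in> nb E w" "x \<noteq> w" if "e \<in> New" "x \<in> e" for x e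
    using form[OF that] split_moved[of x] by simp_all
  have old: "e \<in> E" "e \<notin> (\<lambda>x. {w, x}) ` moved f" if "e \<in> split_at E w f" "e \<notin> New" for e
    using that unfolding split_at_def New_def by simp_all
  show ?thesis
  proof (rule routedI[of _ "\<lambda>e. if e \<in> New then (\<lambda>x. {w, x}) ` e else {e}"])
    show "(if e \<in> New then (\<lambda>x. {w, x}) ` e else {e}) \<subseteq> E" if "e \<in> split_at E w f" for e
    proof (cases "e \<in> New")
      case True
      have "{w, x} \<in> E" if "x \<in> e" for x using m(1)[OF True that] by (simp add: nb_def)
      then show ?thesis using True by auto
    next
      case False
      then show ?thesis using old(1)[OF that] by simp
    qed
  next
    fix x y assume "{x, y} \<in> split_at E w f"
    show "conn (if {x, y} \<in> New then (\<lambda>x. {w, x}) ` {x, y} else {{x, y}}) {w} x y"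
    proof (cases "{x, y} \<in> New")
      case True
      have "conn ((\<lambda>x. {w, x}) ` {x, y}) {w} x y"
        by (intro conn.join[of _ _ x w y] conn.edge) (simp_all add: insert_commute)
      then show ?thesis using True by simp
    next
      case False
      then show ?thesis by (simp add: conn.edge)
    qed
  next
    fix e e' assume e: "e \<in> split_at E w f" "e' \<in> split_at E w f" "e \<noteq> e'"
    have no: "(\<lambda>x. {w, x}) ` a \<inter> {b} = {}" if "a \<in> New" "b \<in> split_at E w f" "b \<notin> New" for a b
      using form[OF that(1)] old(2)[OF that(2,3)] by auto
    have both: "(\<lambda>x. {w, x}) ` e \<inter> (\<lambda>x. {w, x}) ` e' = {}" if "e \<in> New" "e' \<in> New"
    proof -
      have "{w, x} \<noteq> {w, y}" if "x \<in> e" "y \<in> e'" for x y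
      proof
        assume "{w, x} = {w, y}"
        moreover have "x \<noteq> w" "y \<noteq> w"
          using m(2)[OF \<open>e \<in> New\<close>] m(2)[OF \<open>e' \<in> New\<close>] that by simp_all
        ultimately have "x = y" by (simp add: doubleton_eq_iff)
        then show False using same[of e e' x] \<open>e \<in> New\<close> \<open>e' \<in> New\<close> that e(3) by simp
      qed
      then show ?thesis by blast
    qed
    have "{e} \<inter> {e'} = {}" using e(3) by simp
    then show "(if e \<in> New then (\<lambda>x. {w, x}) ` e else {e}) \<inter> (if e' \<in> New then (\<lambda>x. {w, x}) ` e' else {e'}) = {}"
      using both no[of e e'] no[of e' e] e(1,2) by (cases "e \<in> New"; cases "e' \<in> New") (simp_all add: Int_commute)
  qed
qed

end

section \<open>Collecting the vertices that have to be removed together\<close>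

text \<open>Here \<open>N\<close> is the neighbourhood of a vertex that is to be removed. Members of \<open>N\<close> with many non-neighbours
in \<open>N\<close> are left to \<open>perfect_pairing\<close>; the others number fewer than \<open>t\<close> by \<open>almost_complete_clique\<close>,
for which \<open>83 t = 2 (40 t) + 3 t\<close>. They are either put into \<open>R\<close> or matched by \<open>f\<close>. Take for \<open>R\<close> a
largest set of vertices that miss at most \<open>3 |R|\<close> elements of \<open>N\<close>. By maximality, each set \<open>Z\<close> of others has a
member that misses more than \<open>3 (|R| + |Z|)\<close>, hence more than \<open>2 |Z|\<close> elements outside \<open>R\<close>: this is what
\<open>greedy_pairing\<close> asks for.\<close>

lemma dominators_and_pairing:
  assumes "finite N" and fin: "\<And>x. finite (nb E x)" and "83 * t \<le> card N" and "t > 0"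
    and no: "\<not> has_clique E N t"
  shows "\<exists>R f. R \<subseteq> N \<and> (\<forall>z\<in>R. card (N - nb E z) \<le> 3 * card R) \<and> pairing E (N - R) f
     \<and> card R < t \<and> card R + card (moved f) \<le> 2 * t
     \<and> (\<forall>x \<in> N - R - moved f. 40 * t < card (N - nb E x))"
proof -
  define ok where "ok R \<longleftrightarrow> R \<subseteq> N \<and> card R \<le> t \<and> (\<forall>z\<in>R. card (N - nb E z) \<le> 3 * card R)" for R
  have "ok {}" by (simp add: ok_def)
  moreover have "\<forall>R. ok R \<longrightarrow> card R < Suc t" by (simp add: ok_def)
  ultimately have "\<exists>R. ok R \<and> (\<forall>S. ok S \<longrightarrow> card S \<le> card R)"
    by (rule ex_has_greatest_nat)
  then obtain R where R: "ok R" and max': "\<forall>S. ok S \<longrightarrow> card S \<le> card R" by (elim exE conjE)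
  have max: "card S \<le> card R" if "ok S" for S using max' that by simp
  have RN: "R \<subseteq> N" "card R \<le> t" and Rm: "\<And>z. z \<in> R \<Longrightarrow> card (N - nb E z) \<le> 3 * card R"
    using R by (auto simp: ok_def)
  have finR: "finite R" using RN(1) assms(1) finite_subset by blast
  define Y where "Y = {y \<in> N - R. card (N - nb E y) \<le> 40 * t}"
  have YN: "Y \<subseteq> N - R" by (auto simp: Y_def)
  have finY: "finite Y" using YN assms(1) finite_subset by blast
  have RY: "card (R \<union> Y) < t"
  proof (rule ccontr)
    assume "\<not> card (R \<union> Y) < t"
    then have "has_clique E N t"
    proof (intro almost_complete_clique[of N "R \<union> Y" N t E "40 * t"])
      fix x assume "x \<in> R \<union> Y"
      then show "card (N - nb E x) \<le> 40 * t"
        using Rm[of x] RN(2) by (auto simp: Y_def)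
    qed (use assms RN YN finR finY in auto)
    then show False using no by simp
  qed
  have cRY: "card (R \<union> Y) = card R + card Y" using finR finY YN by (intro card_Un_disjoint) auto
  have "\<exists>y\<in>Z. 2 * card Z \<le> card (N - R - nb E y)" if Z: "Z \<subseteq> Y" "Z \<noteq> {}" for Z
  proof -
    have finZ: "finite Z" using Z(1) finY finite_subset by blast
    have cRZ: "card (R \<union> Z) = card R + card Z" using finR finZ Z(1) YN by (intro card_Un_disjoint) auto
    have "card Z > 0" using finZ Z(2) by (simp add: card_gt_0_iff)
    then have "\<not> ok (R \<union> Z)" using max[of "R \<union> Z"] cRZ by auto
    moreover have "card (R \<union> Z) \<le> t"
      using RY card_mono[OF finY Z(1)] cRY cRZ by simp
    moreover have "R \<union> Z \<subseteq> N" using RN(1) Z(1) YN by blast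
    ultimately have "\<not> (\<forall>z\<in>R \<union> Z. card (N - nb E z) \<le> 3 * (card R + card Z))"
      using cRZ unfolding ok_def by simp
    then obtain z where z: "z \<in> R \<union> Z" "card (N - nb E z) > 3 * (card R + card Z)"
      by (meson not_le)
    then have "z \<in> Z" using Rm[of z] by auto
    moreover have "card (N - nb E z) - card R \<le> card (N - nb E z - R)"
      using finR by (rule diff_card_le_card_Diff)
    moreover have "N - nb E z - R = N - R - nb E z" by blast
    ultimately show ?thesis using z(2) by (intro bexI[of _ z]) simp_all
  qed
  then obtain f where f: "pairing E (N - R) f" "Y \<subseteq> moved f" "card (moved f) \<le> 2 * card Y"
    using greedy_pairing[of "N - R" Y E] assms(1) finY YN by auto
  have "40 * t < card (N - nb E x)" if "x \<in> N - R - moved f" for x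
  proof (rule ccontr)
    assume "\<not> 40 * t < card (N - nb E x)"
    then have "x \<in> Y" using that by (simp add: Y_def)
    then show False using f(2) that by blast
  qed
  then show ?thesis using RN(1) Rm f(1,3) RY cRY by (intro exI[of _ R] exI[of _ f]) simp
qed

lemma card_cover2:
  assumes "X \<subseteq> A \<union> B" "finite A" "finite B"
  shows "card X \<le> card A + card B"
  using card_mono[OF _ assms(1)] card_Un_le[of A B] assms(2,3) by simp

lemma card_cover3:
  assumes "X \<subseteq> A \<union> B \<union> C" "finite A" "finite B" "finite C"
  shows "card X \<le> card A + card B + card C"
  using card_cover2[OF assms(1)] card_Un_le[of A B] assms(2-) by simp

text \<open>The list holds the processed vertices, the latest first. Each but the oldest keeps an edge to an older
one; parity defects will be passed along these edges.\<close>

primrec rooted :: "'a set set \<Rightarrow> 'a list \<Rightarrow> bool" where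
  "rooted E [] = True"
| "rooted E (w # ws) = ((ws = [] \<or> (\<exists>p\<in>set ws. {w, p} \<in> E)) \<and> rooted E ws)"

lemma rooted_cong:
  "rooted E ws \<Longrightarrow> (\<And>x y. x \<in> set ws \<Longrightarrow> y \<in> set ws \<Longrightarrow> {x, y} \<in> E \<Longrightarrow> {x, y} \<in> E') \<Longrightarrow> rooted E' ws"
  by (induction ws) auto

text \<open>The state while \<open>Q\<close> is being collected: \<open>E\<^sub>0\<close> is the given graph, \<open>C\<close> the neighbourhood of the start
vertex in it, \<open>E\<close> the current graph and \<open>ws\<close> the members of \<open>Q\<close> at which edges have been split.
Members of \<open>Q\<close> see almost all of \<open>C\<close>, both in \<open>E\<close> and in \<open>E\<^sub>0\<close>. The bound for \<open>E\<close> is the one that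
is inherited when vertices are added. The bound for \<open>E\<^sub>0\<close> is the one that finally gives a clique, and it
follows because an outside vertex has gained at most one neighbour per split. A processed vertex has
only harmless neighbours left outside \<open>Q\<close>: they have about \<open>38 t\<close> non-neighbours among each
other, and every later step destroys at most one of these for the new edge and one for each vertex
added to \<open>Q\<close>.\<close>

definition cluster :: "'a set \<Rightarrow> 'a set set \<Rightarrow> nat \<Rightarrow> 'a set \<Rightarrow> 'a set set \<Rightarrow> 'a set \<Rightarrow> 'a list \<Rightarrow> bool" where
  "cluster V E\<^sub>0 t C E Q ws \<longleftrightarrow>
     graph_on V E \<and> Q \<subseteq> V \<and> distinct ws \<and> set ws \<subseteq> Q \<and> routed E\<^sub>0 (set ws) E \<and>
     (\<forall>x\<in>V - Q. card (nb E x) = card (nb E\<^sub>0 x)) \<and>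
     (\<forall>x\<in>V - Q. card (nb E x - nb E\<^sub>0 x) \<le> length ws) \<and>
     (\<forall>z\<in>Q. card (C - nb E\<^sub>0 z) \<le> 5 * card Q) \<and>
     (\<forall>z\<in>Q. card (C - Q - nb E z) \<le> 3 * card Q + (if z \<in> set ws then 2 * t else 0)) \<and>
     (\<forall>w\<in>set ws. \<forall>x\<in>nb E w - Q.
        38 * t \<le> card (nb E w - Q - nb E x) + card Q + length ws) \<and>
     rooted E ws \<and> (\<forall>z\<in>Q - set ws. Q = {z} \<or> (\<exists>p\<in>set ws. {z, p} \<in> E))"

lemma cluster_step:
  assumes cl: "cluster V E\<^sub>0 t C E Q ws" and "t > 0" and no: "\<not> has_clique E\<^sub>0 V t"
    and g0: "graph_on V E\<^sub>0" and C: "C \<subseteq> V" "200 * t - 1 \<le> card C"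
    and Q: "card Q < t" and w: "w \<in> Q - set ws"
  shows "\<exists>E' Q'. cluster V E\<^sub>0 t C E' Q' (w # ws) \<and> card Q' < t \<and> Q \<subseteq> Q'"
proof -
  note cl = cl[unfolded cluster_def]
  have g: "graph_on V E" and QV: "Q \<subseteq> V" and dist: "distinct ws" and wsQ: "set ws \<subseteq> Q"
    and rt: "routed E\<^sub>0 (set ws) E"
    using cl by blast+
  have deg: "card (nb E x) = card (nb E\<^sub>0 x)" and extra: "card (nb E x - nb E\<^sub>0 x) \<le> length ws"
    if "x \<in> V - Q" for x
    using cl that by blast+
  have miss0: "card (C - nb E\<^sub>0 z) \<le> 5 * card Q"
    and miss: "card (C - Q - nb E z) \<le> 3 * card Q + (if z \<in> set ws then 2 * t else 0)"
    if "z \<in> Q" for z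
    using cl that by blast+
  have light: "38 * t \<le> card (nb E z - Q - nb E x) + card Q + length ws"
    if "z \<in> set ws" "x \<in> nb E z - Q" for z x
    using cl that by blast
  have root: "rooted E ws" "z \<in> Q - set ws \<Longrightarrow> Q = {z} \<or> (\<exists>p\<in>set ws. {z, p} \<in> E)" for z
    using cl by blast+
  have finV: "finite V" using g by (simp add: graph_on_def)
  have finQ: "finite Q" and finC: "finite C" using finV QV C(1) finite_subset by blast+
  note fin = graph_on_nb(2)[OF g]
  have len: "length ws \<le> card Q" using dist wsQ finQ by (metis card_mono distinct_card)

  define N where "N = nb E w - Q"
  have finN: "finite N" using fin by (simp add: N_def)
  have NV: "N \<subseteq> V - Q" using graph_on_nb(1)[OF g] by (auto simp: N_def)
  have wmiss: "card (C - Q - nb E w) \<le> 3 * card Q" using miss[of w] w by simp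
  have "card C \<le> card Q + card (C - Q - nb E w) + card N"
    using finQ finC finN by (intro card_cover3) (auto simp: N_def)
  then have "83 * t \<le> card N" using C(2) Q wmiss \<open>t > 0\<close> by linarith
  moreover have "\<not> has_clique E N t"
  proof
    assume "has_clique E N t"
    then have "has_clique E\<^sub>0 N t" by (rule has_clique_routed[OF rt]) (use NV wsQ in blast)
    then show False using no NV has_clique_mono by blast
  qed
  ultimately have "\<exists>R f. R \<subseteq> N \<and> (\<forall>z\<in>R. card (N - nb E z) \<le> 3 * card R) \<and> pairing E (N - R) f
     \<and> card R < t \<and> card R + card (moved f) \<le> 2 * t
     \<and> (\<forall>x \<in> N - R - moved f. 40 * t < card (N - nb E x))"
    by (intro dominators_and_pairing finN fin \<open>t > 0\<close>)
  then obtain R f where RN: "R \<subseteq> N" and Rm: "\<forall>z\<in>R. card (N - nb E z) \<le> 3 * card R"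
    and f: "pairing E (N - R) f" and Rt: "card R < t" and Rf: "card R + card (moved f) \<le> 2 * t"
    and rest: "\<forall>x \<in> N - R - moved f. 40 * t < card (N - nb E x)"
    by (elim exE conjE)
  define E' where "E' = split_at E w f"
  define Q' where "Q' = Q \<union> R"
  have NRw: "N - R \<subseteq> nb E w" by (auto simp: N_def)
  note nb' = split_nb[OF g f NRw, folded E'_def] and nbw = split_nb_centre[OF g f NRw, folded E'_def]
    and deg' = split_degree[OF g f NRw, folded E'_def]
  have g': "graph_on V E'" using split_graph[OF g f NRw] by (simp add: E'_def)
  note fin' = graph_on_nb(2)[OF g']
  have finR: "finite R" using RN finN finite_subset by blast
  have cQ': "card Q' = card Q + card R"
    unfolding Q'_def using finQ finR RN NV by (intro card_Un_disjoint) auto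
  have mN: "moved f \<subseteq> N - R" using f by (rule pairing_moved)
  have finm: "finite (moved f)" using mN finN finite_subset by blast
  have fixQ: "f z = z" if "z \<in> Q'" for z
    using mN NV that unfolding moved_def Q'_def by blast
  have nbQ: "nb E' z = nb E z" if "z \<in> Q'" "z \<noteq> w" for z
    using nb'[OF that(2)] fixQ[OF that(1)] by simp
  have RV: "R \<subseteq> V - Q" using RN NV by blast
  have wR: "w \<notin> R" "w \<notin> set ws" "w \<in> Q" using w RV by blast+
  have wsR: "set ws \<inter> R = {}" using wsQ RV by blast
  have gain: "nb E' x \<subseteq> insert (f x) (nb E x)" if "x \<noteq> w" for x
    using nb'[OF that] by auto

  \<comment> \<open>A new vertex misses in \<open>C\<close> what \<open>w\<close> misses and at most \<open>3 |R|\<close> more: misses are additive along chains.\<close>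
  have Rmiss: "card (C - Q - nb E z) \<le> 3 * card Q + 3 * card R"
    if "z \<in> R" for z
  proof -
    have "card (C - Q - nb E z) \<le> card (C - Q - nb E w) + card (N - nb E z)"
      using finC finN by (intro card_cover2) (auto simp: N_def)
    then show ?thesis using wmiss Rm that by fastforce
  qed
  have miss0': "card (C - nb E\<^sub>0 z) \<le> 5 * card Q'" if "z \<in> Q'" for z
  proof (cases "z \<in> Q")
    case True
    then show ?thesis using miss0[of z] cQ' by simp
  next
    case False
    then have zR: "z \<in> R" using that by (simp add: Q'_def)
    have "card (C - nb E\<^sub>0 z) \<le> card Q + card (C - Q - nb E z) + card (nb E z - nb E\<^sub>0 z)"
      using finC finQ fin by (intro card_cover3) auto
    moreover have "card (nb E z - nb E\<^sub>0 z) \<le> card Q" using extra[of z] zR RV len by fastforce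
    ultimately show ?thesis using Rmiss[OF zR] cQ' by simp
  qed
  \<comment> \<open>The new set has fewer than \<open>2 t\<close> elements, so each of them misses at most \<open>5 (2 t)\<close> elements of \<open>C\<close>.\<close>
  have "card Q' < t"
  proof (rule ccontr)
    assume "\<not> card Q' < t"
    then have "has_clique E\<^sub>0 V t"
    proof (intro almost_complete_clique[of C Q' V t E\<^sub>0 "10 * t"])
      fix x assume "x \<in> Q'"
      then show "card (C - nb E\<^sub>0 x) \<le> 10 * t" using miss0'[of x] cQ' Q Rt by linarith
    qed (use finC finQ finR QV RV C \<open>t > 0\<close> graph_on_nb(2)[OF g0] in \<open>auto simp: Q'_def\<close>)
    then show False using no by simp
  qed
  moreover have "cluster V E\<^sub>0 t C E' Q' (w # ws)"
    unfolding cluster_def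
  proof (intro conjI ballI)
    show "graph_on V E'" by (rule g')
    show "Q' \<subseteq> V" using QV RV by (auto simp: Q'_def)
    show "distinct (w # ws)" using dist wR by simp
    show "set (w # ws) \<subseteq> Q'" using wsQ wR by (auto simp: Q'_def)
    have "routed E\<^sub>0 (set (w # ws)) E" using rt by (rule routed_mono) auto
    moreover have "routed E (set (w # ws)) E'"
      using split_routed[OF g f NRw] unfolding E'_def by (rule routed_mono) simp
    ultimately show "routed E\<^sub>0 (set (w # ws)) E'" by (rule routed_trans)
  next
    fix x assume "x \<in> V - Q'"
    then have x: "x \<in> V - Q" "x \<noteq> w" using wR by (auto simp: Q'_def)
    show "card (nb E' x) = card (nb E\<^sub>0 x)" using deg'[OF x(2)] deg[OF x(1)] by simp
    have "card (nb E' x - nb E\<^sub>0 x) \<le> card (nb E x - nb E\<^sub>0 x) + card {f x}"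
      using gain[OF x(2)] fin by (intro card_cover2) auto
    then show "card (nb E' x - nb E\<^sub>0 x) \<le> length (w # ws)" using extra[OF x(1)] by simp
  next
    fix z assume z: "z \<in> Q'"
    show "card (C - nb E\<^sub>0 z) \<le> 5 * card Q'" using z by (rule miss0')
    show "card (C - Q' - nb E' z) \<le> 3 * card Q' + (if z \<in> set (w # ws) then 2 * t else 0)"
    proof (cases "z = w")
      case True
      have "card (C - Q' - nb E' z) \<le> card (C - Q - nb E w) + card (moved f)"
        using finC finm unfolding True nbw by (intro card_cover2) (auto simp: Q'_def)
      then show ?thesis using wmiss Rf cQ' True by simp
    next
      case False
      have "card (C - Q' - nb E' z) \<le> card (C - Q - nb E z)"
        using finC unfolding nbQ[OF z False] by (intro card_mono) (auto simp: Q'_def)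
      moreover have "card (C - Q - nb E z) \<le> 3 * card Q' + (if z \<in> set ws then 2 * t else 0)"
      proof (cases "z \<in> Q")
        case True
        then show ?thesis using miss[OF True] cQ' by simp
      next
        case False
        then show ?thesis using Rmiss[of z] z cQ' by (simp add: Q'_def)
      qed
      ultimately show ?thesis using False by simp
    qed
  next
    fix z x assume z: "z \<in> set (w # ws)" and x: "x \<in> nb E' z - Q'"
    have xw: "x \<noteq> w" using x wR by (auto simp: Q'_def)
    show "38 * t \<le> card (nb E' z - Q' - nb E' x) + card Q' + length (w # ws)"
    proof (cases "z = w")
      case True
      then have xN: "x \<in> N - R - moved f" using x nbw by (auto simp: N_def Q'_def)
      then have "nb E' x = nb E x" using nb'[OF xw] by (simp add: moved_def)
      then have "card (N - nb E x) \<le> card (nb E' z - Q' - nb E' x) + card R + card (moved f)"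
        using fin fin' finR finm unfolding True nbw by (intro card_cover3) (auto simp: N_def Q'_def)
      moreover have "40 * t < card (N - nb E x)" using rest xN by blast
      ultimately show ?thesis using Rf by simp
    next
      case False
      then have zws: "z \<in> set ws" "z \<in> Q'" using z wsQ by (auto simp: Q'_def)
      have nbz: "nb E' z = nb E z" using nbQ zws False by simp
      have "card (nb E z - Q - nb E x) \<le> card (nb E' z - Q' - nb E' x) + card R + card {f x}"
        using fin fin' finR gain[OF xw] unfolding nbz by (intro card_cover3) (auto simp: Q'_def nbz)
      moreover have "38 * t \<le> card (nb E z - Q - nb E x) + card Q + length ws"
        using light zws(1) x nbz by (auto simp: Q'_def)
      ultimately show ?thesis using cQ' by simp
    qed
  next
    have keep: "{x, y} \<in> E'" if "x \<in> Q'" "y \<in> Q'" "{x, y} \<in> E" for x y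
    proof -
      have "y \<in> nb E x" using that(3) by (simp add: nb_def)
      moreover have "y \<notin> moved f" using fixQ[OF that(2)] by (simp add: moved_def)
      ultimately have "y \<in> nb E' x" using nbw nbQ[OF that(1)] by (cases "x = w") auto
      then show ?thesis by (simp add: nb_def)
    qed
    have wsQ': "set ws \<subseteq> Q'" "w \<in> Q'" using wsQ wR by (auto simp: Q'_def)
    have "rooted E' ws" by (rule rooted_cong[OF root(1)]) (use keep wsQ' in blast)
    moreover have "ws = [] \<or> (\<exists>p\<in>set ws. {w, p} \<in> E')" 
    proof -
      have "ws = []" if "Q = {w}" using wsQ wR(2) that by (cases ws) auto
      then show ?thesis using root(2)[OF w] keep wsQ' by blast
    qed
    ultimately show "rooted E' (w # ws)" by simp
    fix z assume z: "z \<in> Q' - set (w # ws)"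
    show "Q' = {z} \<or> (\<exists>p\<in>set (w # ws). {z, p} \<in> E')"
    proof (cases "z \<in> Q")
      case True
      have "Q \<noteq> {z}" using z wR(3) by auto
      then have "\<exists>p\<in>set ws. {z, p} \<in> E" using root(2)[of z] True z by simp
      then show ?thesis using z keep wsQ' by auto
    next
      case False
      then have "z \<in> N" using z RN by (auto simp: Q'_def)
      then have "{z, w} \<in> E" by (auto simp: N_def nb_def insert_commute)
      then show ?thesis using keep z wsQ' by auto
    qed
  qed
  moreover have "Q \<subseteq> Q'" by (auto simp: Q'_def)
  ultimately show ?thesis by blast
qed

lemma cluster_closed:
  assumes "t > 0" and "\<not> has_clique E\<^sub>0 V t"
    and "graph_on V E\<^sub>0" and "C \<subseteq> V" "200 * t - 1 \<le> card C"
  shows "cluster V E\<^sub>0 t C E Q ws \<Longrightarrow> card Q < t \<Longrightarrow>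
    \<exists>E' Q' ws'. cluster V E\<^sub>0 t C E' Q' ws' \<and> card Q' < t \<and> set ws' = Q' \<and> Q \<subseteq> Q'"
proof (induction "t - length ws" arbitrary: E Q ws rule: less_induct)
  case less
  have wsQ: "set ws \<subseteq> Q" "distinct ws" "Q \<subseteq> V" "finite V"
    using less.prems(1) by (auto simp: cluster_def graph_on_def)
  then have "length ws \<le> card Q" by (metis card_mono distinct_card finite_subset)
  then have len: "length ws < t" using less.prems(2) by simp
  show ?case
  proof (cases "set ws = Q")
    case True
    then show ?thesis using less.prems by blast
  next
    case False
    then obtain w where w: "w \<in> Q - set ws" using wsQ(1) by blast
    obtain E' Q' where "cluster V E\<^sub>0 t C E' Q' (w # ws)" "card Q' < t" and sub: "Q \<subseteq> Q'"
      using cluster_step[OF less.prems(1) assms less.prems(2) w] by (elim exE conjE)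
    moreover have "t - length (w # ws) < t - length ws" using len by simp
    ultimately have "\<exists>E'' Q'' ws'. cluster V E\<^sub>0 t C E'' Q'' ws' \<and> card Q'' < t \<and> set ws' = Q'' \<and> Q' \<subseteq> Q''"
      using less.hyps by blast
    then show ?thesis using sub by (elim exE conjE) (intro exI conjI, assumption+, rule subset_trans)
  qed
qed

lemma cluster_start:
  assumes "graph_on V E" and "v \<in> V"
  shows "cluster V E t (nb E v) E {v} []"
proof -
  have none: "nb E v - {v} - nb E v = {}" by blast
  have "card (nb E v - {v} - nb E v) = 0" unfolding none by simp
  then show ?thesis using assms by (simp add: cluster_def routed_subset)
qed

section \<open>Removing the collected vertices\<close>

definition delete_vertex :: "'a set set \<Rightarrow> 'a \<Rightarrow> 'a set set" where
  "delete_vertex E w = {e \<in> E. w \<notin> e}"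

lemma nb_delete_vertex: "nb (delete_vertex E w) x = (if x = w then {} else nb E x - {w})"
  by (auto simp: nb_def delete_vertex_def)

text \<open>Splitting has already taken \<open>w\<close> away from its neighbours in \<open>B\<close> and given them a new neighbour instead;
only the other neighbours of \<open>w\<close> still have an edge to lose when \<open>w\<close> is deleted.\<close>

lemma clear_vertex:
  assumes g: "graph_on V E" and f: "pairing E B f" "moved f = B" and B: "B \<subseteq> nb E w"
  defines "E' \<equiv> delete_vertex (split_at E w f) w"
  shows "graph_on V E'" "routed E {w} E'" "nb E' w = {}"
    "\<And>x. x \<noteq> w \<Longrightarrow> x \<notin> B \<Longrightarrow> nb E' x = nb E x - {w}"
    "\<And>x. x \<noteq> w \<Longrightarrow> nb E' x \<subseteq> insert (f x) (nb E x)"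
    "\<And>x. x \<noteq> w \<Longrightarrow> card (nb E x) = card (nb E' x) + (if x \<in> nb E w - B then 1 else 0)"
proof -
  note nb' = split_nb[OF g f(1) B] and deg' = split_degree[OF g f(1) B]
  note m = split_moved[OF g f(1) B]
  show "graph_on V E'"
    using split_graph[OF g f(1) B] by (auto simp: E'_def graph_on_def delete_vertex_def)
  have "routed (split_at E w f) {w} E'"
    by (rule routed_subset) (auto simp: E'_def delete_vertex_def)
  with split_routed[OF g f(1) B] show "routed E {w} E'" by (rule routed_trans)
  show "nb E' w = {}" by (simp add: E'_def nb_delete_vertex)
  fix x assume x: "x \<noteq> w"
  have E'x: "nb E' x = nb (split_at E w f) x - {w}" using x by (simp add: E'_def nb_delete_vertex)
  show "nb E' x \<subseteq> insert (f x) (nb E x)" using nb'[OF x] E'x by auto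
  show "nb E' x = nb E x - {w}" if "x \<notin> B"
    using that nb'[OF x] E'x f(2) by (auto simp: moved_def)
  show "card (nb E x) = card (nb E' x) + (if x \<in> nb E w - B then 1 else 0)"
  proof (cases "x \<in> nb E w - B")
    case True
    then have "f x = x" "w \<in> nb E x" using f(2) nb_sym[of w E x] by (auto simp: moved_def)
    then show ?thesis
      using True E'x nb'[OF x] card_Suc_Diff1[of "nb E x" w] graph_on_nb(2)[OF g, of x] by simp
  next
    case False
    have "w \<notin> nb (split_at E w f) x"
    proof (cases "x \<in> B")
      case True
      then show ?thesis using nb'[OF x] m[of x] f(2) by (auto simp: moved_def)
    next
      case nB: False
      then have "f x = x" using f(2) by (auto simp: moved_def)
      then show ?thesis using nb'[OF x] False nB nb_sym[of w E x] by simp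
    qed
    then show ?thesis using E'x deg'[OF x] False by simp
  qed
qed

lemma reroute:
  assumes g: "graph_on V E"
    and e: "{u, w} \<in> E" "{w, p} \<in> E" "{p, y} \<in> E"
    and new: "{u, y} \<notin> E" "u \<noteq> y" "u \<noteq> p" "w \<noteq> y"
  defines "E' \<equiv> insert {u, y} (E - {{u, w}, {w, p}, {p, y}})"
  shows "graph_on V E'" "routed E {w, p} E'"
    "nb E' u = insert y (nb E u - {w})" "nb E' y = insert u (nb E y - {p})"
    "nb E' w = nb E w - {u, p}" "nb E' p = nb E p - {w, y}"
    "\<And>x. x \<notin> {u, w, p, y} \<Longrightarrow> nb E' x = nb E x"
proof -
  have ne: "u \<noteq> w" "w \<noteq> p" "p \<noteq> y" using g e by (auto simp: graph_on_def)
  have V: "u \<in> V" "y \<in> V" using g e by (auto simp: graph_on_def)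
  show "graph_on V E'" using g V new(2) by (auto simp: graph_on_def E'_def)
  show "routed E {w, p} E'"
    unfolding E'_def
  proof (rule routed_replace)
    have "conn {{u, w}, {w, p}, {p, y}} {w, p} u p"
      by (rule conn.join[of _ _ u w p]) (simp_all add: conn.edge)
    then show "conn {{u, w}, {w, p}, {p, y}} {w, p} u y"
      by (rule conn.join) (simp_all add: conn.edge)
  qed (use e in simp)
  show "nb E' u = insert y (nb E u - {w})" "nb E' y = insert u (nb E y - {p})"
    "nb E' w = nb E w - {u, p}" "nb E' p = nb E p - {w, y}"
    using ne new by (auto simp: nb_def E'_def doubleton_eq_iff)
  show "nb E' x = nb E x" if "x \<notin> {u, w, p, y}" for x
    using that by (auto simp: nb_def E'_def doubleton_eq_iff)
qed

text \<open>The state while \<open>Q\<close> is being removed; \<open>ws\<close> are the members still present. The constants have slack for the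
removals to come: each costs a remaining vertex of \<open>Q\<close> at most one neighbour in \<open>C\<close>, and costs the
harmless neighbours of that vertex at most three non-neighbours.\<close>

definition dissolving ::
    "'a set \<Rightarrow> 'a set set \<Rightarrow> nat \<Rightarrow> 'a set \<Rightarrow> 'a set \<Rightarrow> 'a set set \<Rightarrow> 'a list \<Rightarrow> bool" where
  "dissolving V E\<^sub>0 t C Q E ws \<longleftrightarrow>
     graph_on V E \<and> distinct ws \<and> set ws \<subseteq> Q \<and> routed E\<^sub>0 Q E \<and>
     (\<forall>x\<in>V - Q. card (nb E\<^sub>0 x) \<le> card (nb E x)) \<and>
     (\<forall>z\<in>Q - set ws. nb E z = {}) \<and>
     (\<forall>z\<in>set ws. card (C - Q - nb E z) + length ws \<le> 5 * t + card Q) \<and>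
     (\<forall>w\<in>set ws. \<forall>x\<in>nb E w - Q.
        36 * t + 3 * length ws \<le> card (nb E w - Q - nb E x) + 3 * card Q) \<and>
     rooted E ws"

lemma cluster_dissolving:
  assumes "cluster V E\<^sub>0 t C E Q ws" and "set ws = Q" and "card Q < t"
  shows "dissolving V E\<^sub>0 t C Q E ws"
proof -
  note cl = assms(1)[unfolded cluster_def]
  have len: "length ws = card Q" using cl assms(2) distinct_card by metis
  have "card (C - Q - nb E z) + length ws \<le> 5 * t + card Q" if "z \<in> set ws" for z
  proof -
    have "card (C - Q - nb E z) \<le> 3 * card Q + (if z \<in> set ws then 2 * t else 0)"
      using cl that assms(2) by blast
    then show ?thesis using that len assms(3) by simp
  qed
  moreover have "36 * t + 3 * length ws \<le> card (nb E w - Q - nb E x) + 3 * card Q"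
    if "w \<in> set ws" "x \<in> nb E w - Q" for w x
  proof -
    have "38 * t \<le> card (nb E w - Q - nb E x) + card Q + length ws" using cl that by blast
    then show ?thesis using len assms(3) by simp
  qed
  ultimately show ?thesis using cl assms(2) unfolding dissolving_def by auto
qed

text \<open>Let \<open>p\<close> be an older neighbour of \<open>w\<close> in \<open>Q\<close>. Both see almost all of \<open>C\<close>, so they have a common neighbour
\<open>u\<close> outside \<open>Q\<close>. As \<open>u\<close> is a harmless neighbour of \<open>p\<close>, it has a non-neighbour \<open>y\<close> among the
neighbours of \<open>p\<close>. Replacing the path \<open>u w p y\<close> by the edge \<open>u y\<close> preserves the degrees of \<open>u\<close> and
\<open>y\<close>, while \<open>w\<close> and \<open>p\<close> lose one neighbour outside \<open>Q\<close> each.\<close>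

lemma make_even:
  assumes d: "dissolving V E\<^sub>0 t C Q E (w # ws)" and ws: "ws \<noteq> []"
    and Q: "card Q < t" "finite Q" and C: "finite C" "200 * t - 1 \<le> card C"
  shows "\<exists>E' y. graph_on V E' \<and> routed E Q E' \<and> even (card (nb E' w - Q)) \<and>
     nb E' w \<subseteq> nb E w \<and> card (nb E w - Q - nb E' w) \<le> 1 \<and>
     (\<forall>x\<in>V - Q. card (nb E' x) = card (nb E x) \<and> (\<exists>a. nb E' x \<subseteq> insert a (nb E x))) \<and>
     (\<forall>z\<in>Q - set (w # ws). nb E' z = {}) \<and>
     (\<forall>z\<in>set ws. nb E z - {w, y} \<subseteq> nb E' z \<and> nb E' z \<subseteq> nb E z) \<and> y \<notin> Q - {w}"
proof (cases "even (card (nb E w - Q))")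
  case True
  have none: "nb E w - Q - nb E w = {}" by blast
  have "card (nb E w - Q - nb E w) = 0" unfolding none by simp
  \<comment> \<open>Nothing is rerouted; \<open>w\<close> stands in for the absent \<open>y\<close>.\<close>
  then show ?thesis using d True
    by (intro exI[of _ E] exI[of _ w]) (auto simp: dissolving_def routed_subset)
next
  case odd: False
  note d = d[unfolded dissolving_def]
  have g: "graph_on V E" using d by blast
  note fin = graph_on_nb(2)[OF g]
  obtain p where p: "p \<in> set ws" "{w, p} \<in> E" using d ws by auto
  have wp: "w \<noteq> p" "w \<in> Q" "p \<in> Q" using d p(1) by auto
  have "card (C - Q - nb E w) \<le> 6 * t" "card (C - Q - nb E p) \<le> 6 * t"
    using d Q(1) p(1) by fastforce+
  moreover have "card (C - Q) \<le> card (nb E w \<inter> nb E p - Q) + card (C - Q - nb E w) + card (C - Q - nb E p)"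
    using C(1) fin by (intro card_cover3) auto
  moreover have "card C - card Q \<le> card (C - Q)" using Q(2) by (rule diff_card_le_card_Diff)
  ultimately have "card (nb E w \<inter> nb E p - Q) > 0" using C(2) Q(1) by linarith
  then obtain u where u: "u \<in> nb E w" "u \<in> nb E p" "u \<notin> Q" by (auto simp: card_gt_0_iff)
  have "36 * t + 3 * length (w # ws) \<le> card (nb E p - Q - nb E u) + 3 * card Q"
    using d p(1) u by auto
  then have "card {u} < card (nb E p - Q - nb E u)" using Q(1) by simp
  then have "\<not> nb E p - Q - nb E u \<subseteq> {u}" using card_mono[of "{u}" "nb E p - Q - nb E u"] by auto
  then obtain y where y: "y \<in> nb E p" "y \<notin> Q" "y \<notin> nb E u" "y \<noteq> u" by blast
  define E' where "E' = insert {u, y} (E - {{u, w}, {w, p}, {p, y}})"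
  have e: "{u, w} \<in> E" "{p, y} \<in> E" "{u, y} \<notin> E" "u \<noteq> p" "w \<noteq> y" "u \<noteq> y" "u \<noteq> w" "y \<noteq> p"
    using u y wp by (auto simp: nb_def insert_commute)
  note r = reroute[OF g e(1) p(2) e(2,3,6,4,5), folded E'_def]
  have "nb E w - Q = insert u (nb E' w - Q)" "u \<notin> nb E' w - Q" using u wp r(5) by auto
  then have "card (nb E w - Q) = Suc (card (nb E' w - Q))"
    using graph_on_nb(2)[OF r(1)] by simp
  then have ev: "even (card (nb E' w - Q))" using odd by simp
  have fix_card: "card (insert a (nb E x - {b})) = card (nb E x)" if "a \<notin> nb E x" "b \<in> nb E x" for a b x
    using that fin[of x] card_Suc_Diff1[of "nb E x" b] by simp
  have "w \<in> nb E u" using u(1) by (rule nb_sym[THEN iffD1])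
  moreover have "p \<in> nb E y" using y(1) by (rule nb_sym[THEN iffD1])
  moreover have "u \<notin> nb E y" using y(3) nb_sym[of u E y] by simp
  ultimately have cu: "card (nb E' u) = card (nb E u)" "card (nb E' y) = card (nb E y)"
    using r(3,4) fix_card y(3) by simp_all
  have other: "card (nb E' x) = card (nb E x) \<and> (\<exists>a. nb E' x \<subseteq> insert a (nb E x))" if x: "x \<in> V - Q" for x
  proof -
    consider "x = u" | "x = y" | "x \<notin> {u, w, p, y}" using x wp(2,3) by auto
    then show ?thesis
    proof cases
      case 1
      then show ?thesis using cu r(3) by blast
    next
      case 2
      then show ?thesis using cu r(4) by blast
    next
      case 3
      then show ?thesis using r(7)[OF 3] by auto
    qed
  qed
  show ?thesis
  proof (rule exI[of _ E'], rule exI[of _ y], intro conjI ballI)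
    show "graph_on V E'" by (rule r(1))
    show "routed E Q E'" using r(2) by (rule routed_mono) (use wp in simp)
    show "even (card (nb E' w - Q))" by (rule ev)
    show "nb E' w \<subseteq> nb E w" using r(5) by blast
    have "card (nb E w - Q - nb E' w) \<le> card {u}" using r(5) wp by (intro card_mono) auto
    then show "card (nb E w - Q - nb E' w) \<le> 1" by simp
  next
    fix x assume x: "x \<in> V - Q"
    show "card (nb E' x) = card (nb E x)" using other[OF x] by (rule conjunct1)
    show "\<exists>a. nb E' x \<subseteq> insert a (nb E x)" using other[OF x] by (rule conjunct2)
  next
    fix z assume z: "z \<in> Q - set (w # ws)"
    then have "z \<notin> {u, w, p, y}" using u y p by auto
    then have "nb E' z = nb E z" by (rule r(7))
    then show "nb E' z = {}" using d z by simp
  next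
    fix z assume z: "z \<in> set ws"
    then have "z = p \<or> z \<notin> {u, w, p, y}" using d u y by auto
    then show "nb E z - {w, y} \<subseteq> nb E' z" "nb E' z \<subseteq> nb E z" using r(6,7) by auto
  next
    show "y \<notin> Q - {w}" using y by simp
  qed
qed

lemma dissolve_step:
  assumes d: "dissolving V E\<^sub>0 t C Q E (w # ws)" and ws: "ws \<noteq> []"
    and Q: "card Q < t" "Q \<subseteq> V" and C: "finite C" "200 * t - 1 \<le> card C"
    and no: "\<not> has_clique E\<^sub>0 V t"
  shows "\<exists>E'. dissolving V E\<^sub>0 t C Q E' ws"
proof -
  have finV: "finite V" using d by (simp add: dissolving_def graph_on_def)
  have finQ: "finite Q" using Q(2) finV finite_subset by blast
  obtain E1 y where g1: "graph_on V E1" and rt1: "routed E Q E1" and ev: "even (card (nb E1 w - Q))"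
    and w1: "nb E1 w \<subseteq> nb E w" "card (nb E w - Q - nb E1 w) \<le> 1"
    and out1: "\<forall>x\<in>V - Q. card (nb E1 x) = card (nb E x) \<and> (\<exists>a. nb E1 x \<subseteq> insert a (nb E x))"
    and gone1: "\<forall>z\<in>Q - set (w # ws). nb E1 z = {}"
    and in1: "\<forall>z\<in>set ws. nb E z - {w, y} \<subseteq> nb E1 z \<and> nb E1 z \<subseteq> nb E z" and yQ: "y \<notin> Q - {w}"
    using make_even[OF d ws Q(1) finQ C] by (elim exE conjE)
  note d = d[unfolded dissolving_def]
  have g: "graph_on V E" and rt0: "routed E\<^sub>0 Q E" using d by blast+
  note fin = graph_on_nb(2)[OF g] and fin1 = graph_on_nb(2)[OF g1]
  have wws: "w \<in> Q" "w \<notin> set ws" "set ws \<subseteq> Q" using d by auto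
  define B where "B = nb E1 w - Q"
  have BV: "B \<subseteq> V - Q" using graph_on_nb(1)[OF g1] by (auto simp: B_def)
  have rt01: "routed E\<^sub>0 Q E1" using rt0 rt1 by (rule routed_trans)
  have len: "length (w # ws) \<le> card Q" using d finQ by (metis card_mono distinct_card)
  have "\<exists>f. pairing E1 B f \<and> moved f = B"
  proof (rule perfect_pairing[of B E1 t])
    show "finite B" using fin1 by (simp add: B_def)
    show "even (card B)" using ev by (simp add: B_def)
    show "\<not> has_clique E1 B t"
    proof
      assume "has_clique E1 B t"
      then have "has_clique E\<^sub>0 B t" by (rule has_clique_routed[OF rt01]) (use BV in blast)
      then show False using no BV has_clique_mono by blast
    qed
    fix x assume x: "x \<in> B"
    obtain a where a: "nb E1 x \<subseteq> insert a (nb E x)" using out1 x BV by blast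
    have "card (nb E w - Q - nb E x) \<le> card (B - nb E1 x) + card (nb E w - Q - nb E1 w) + card {a}"
      using fin fin1 a by (intro card_cover3) (auto simp: B_def)
    moreover have "36 * t + 3 * length (w # ws) \<le> card (nb E w - Q - nb E x) + 3 * card Q"
      using d x w1(1) by (auto simp: B_def)
    ultimately show "4 * t + 1 \<le> card (B - nb E1 x)" using w1(2) Q(1) by simp
  qed (rule fin1)
  then obtain f where f: "pairing E1 B f" "moved f = B" by (elim exE conjE)
  have Bw: "B \<subseteq> nb E1 w" by (auto simp: B_def)
  define E' where "E' = delete_vertex (split_at E1 w f) w"
  note c = clear_vertex[OF g1 f Bw, folded E'_def]
  have inQ: "nb E' z = nb E1 z - {w}" if "z \<in> Q" "z \<noteq> w" for z
    using c(4)[OF that(2)] that(1) BV by blast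
  have "dissolving V E\<^sub>0 t C Q E' ws"
    unfolding dissolving_def
  proof (intro conjI ballI)
    show "graph_on V E'" by (rule c(1))
    show "distinct ws" "set ws \<subseteq> Q" using d by auto
    have "routed E1 Q E'" using c(2) by (rule routed_mono) (use wws in simp)
    with rt01 show "routed E\<^sub>0 Q E'" by (rule routed_trans)
  next
    fix x assume x: "x \<in> V - Q"
    then have "x \<noteq> w" "x \<notin> nb E1 w - B" using wws by (auto simp: B_def)
    then have "card (nb E' x) = card (nb E1 x)" using c(6)[of x] by simp
    then show "card (nb E\<^sub>0 x) \<le> card (nb E' x)" using out1 x d by auto
  next
    fix z assume z: "z \<in> Q - set ws"
    show "nb E' z = {}"
    proof (cases "z = w")
      case False
      then have "nb E1 z = {}" using gone1 z by simp
      then show ?thesis using inQ[of z] z False by simp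
    qed (simp add: c(3))
  next
    fix z assume z: "z \<in> set ws"
    then have zw: "z \<in> Q" "z \<noteq> w" using wws by auto
    have "card (C - Q - nb E' z) \<le> card (C - Q - nb E z) + card {y}"
      using C(1) in1 z wws(1) inQ[OF zw] by (intro card_cover2) auto
    moreover have "card (C - Q - nb E z) + length (w # ws) \<le> 5 * t + card Q" using d z by auto
    ultimately show "card (C - Q - nb E' z) + length ws \<le> 5 * t + card Q" by simp
  next
    fix z x assume z: "z \<in> set ws" and x: "x \<in> nb E' z - Q"
    then have zw: "z \<in> Q" "z \<noteq> w" "x \<noteq> w" "x \<in> V - Q" using wws graph_on_nb(1)[OF c(1)] by auto
    have xz: "x \<in> nb E z - Q" using x inQ[OF zw(1,2)] in1 z by auto
    obtain a where a: "nb E1 x \<subseteq> insert a (nb E x)" using out1 zw(4) by blast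
    have "nb E z - Q - nb E x \<subseteq> (nb E' z - Q - nb E' x) \<union> {y} \<union> {a, f x}"
      using a c(5)[OF zw(3)] inQ[OF zw(1,2)] in1 z wws(1) by fastforce
    then have "card (nb E z - Q - nb E x) \<le> card (nb E' z - Q - nb E' x) + card {y} + card {a, f x}"
      using graph_on_nb(2)[OF c(1)] by (intro card_cover3) auto
    moreover have "card {a, f x} \<le> 2" by (simp add: card_insert_if)
    moreover have "36 * t + 3 * length (w # ws) \<le> card (nb E z - Q - nb E x) + 3 * card Q"
      using d z xz by auto
    ultimately show "36 * t + 3 * length ws \<le> card (nb E' z - Q - nb E' x) + 3 * card Q" by simp
  next
    have "{x, z} \<in> E'" if "x \<in> set ws" "z \<in> set ws" "{x, z} \<in> E" for x z
    proof -
      have "z \<in> nb E x" "z \<noteq> w" "z \<noteq> y" "x \<noteq> w" "x \<in> Q" using that wws yQ by (auto simp: nb_def)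
      then have "z \<in> nb E' x" using in1 that(1) inQ[of x] by auto
      then show ?thesis by (simp add: nb_def)
    qed
    moreover have "rooted E ws" using d by simp
    ultimately show "rooted E' ws" by (rule rooted_cong[rotated])
  qed
  then show ?thesis by blast
qed

text \<open>There is no older vertex to which a parity defect could be passed, so one neighbour \<open>u\<close> is left out
of the matching and loses an edge.\<close>

lemma dissolve_last:
  assumes d: "dissolving V E\<^sub>0 t C Q E [w]"
    and Q: "card Q < t" "Q \<subseteq> V" and no: "\<not> has_clique E\<^sub>0 V t"
  shows "\<exists>E' u. graph_on V E' \<and> routed E\<^sub>0 Q E' \<and> (\<forall>z\<in>Q. nb E' z = {}) \<and>
     (\<forall>x\<in>V - Q. card (nb E\<^sub>0 x) \<le> card (nb E' x) + (if x = u then 1 else 0))"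
proof -
  note d = d[unfolded dissolving_def]
  have g: "graph_on V E" and rt0: "routed E\<^sub>0 Q E" and w: "w \<in> Q" using d by auto
  have finQ: "finite Q" using Q(2) g finite_subset by (auto simp: graph_on_def)
  note fin = graph_on_nb(2)[OF g]
  obtain u where u: "even (card (nb E w - Q - {u}))"
  proof (cases "even (card (nb E w - Q))")
    case True
    \<comment> \<open>Leaving out \<open>w\<close>, which is in \<open>Q\<close>, leaves out nothing.\<close>
    then have "even (card (nb E w - Q - {w}))" using w by simp
    then show ?thesis by (rule that)
  next
    case False
    have "card (nb E w - Q) \<noteq> 0" using False by (metis even_zero)
    then have "nb E w - Q \<noteq> {}" by (metis card.empty)
    then obtain u where "u \<in> nb E w - Q" by blast
    then have "card (nb E w - Q) = Suc (card (nb E w - Q - {u}))"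
      using fin[of w] card_Suc_Diff1[of "nb E w - Q" u] by simp
    then have "even (card (nb E w - Q - {u}))" using False by simp
    then show ?thesis by (rule that)
  qed
  define B where "B = nb E w - Q - {u}"
  have BV: "B \<subseteq> V - Q" using graph_on_nb(1)[OF g] by (auto simp: B_def)
  have "\<exists>f. pairing E B f \<and> moved f = B"
  proof (rule perfect_pairing[of B E t])
    show "finite B" using fin by (simp add: B_def)
    show "even (card B)" using u by (simp add: B_def)
    show "\<not> has_clique E B t"
    proof
      assume "has_clique E B t"
      then have "has_clique E\<^sub>0 B t" by (rule has_clique_routed[OF rt0]) (use BV in blast)
      then show False using no BV has_clique_mono by blast
    qed
    fix x assume x: "x \<in> B"
    have "card (nb E w - Q - nb E x) \<le> card (B - nb E x) + card {u}"
      using fin by (intro card_cover2) (auto simp: B_def)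
    moreover have "36 * t + 3 * length [w] \<le> card (nb E w - Q - nb E x) + 3 * card Q"
      using d x by (auto simp: B_def)
    ultimately show "4 * t + 1 \<le> card (B - nb E x)" using Q(1) by simp
  qed (rule fin)
  then obtain f where f: "pairing E B f" "moved f = B" by (elim exE conjE)
  have Bw: "B \<subseteq> nb E w" by (auto simp: B_def)
  define E' where "E' = delete_vertex (split_at E w f) w"
  note c = clear_vertex[OF g f Bw, folded E'_def]
  show ?thesis
  proof (intro exI[of _ E'] exI[of _ u] conjI ballI)
    show "graph_on V E'" by (rule c(1))
    have "routed E Q E'" using c(2) by (rule routed_mono) (use w in simp)
    with rt0 show "routed E\<^sub>0 Q E'" by (rule routed_trans)
    show "nb E' z = {}" if "z \<in> Q" for z
    proof (cases "z = w")
      case False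
      then have "nb E z = {}" "z \<notin> B" using d that BV by auto
      then show ?thesis using c(4)[OF False] by simp
    qed (simp add: c(3))
    fix x assume x: "x \<in> V - Q"
    then have xw: "x \<noteq> w" and xu: "x \<in> nb E w - B \<Longrightarrow> x = u" using w by (auto simp: B_def)
    have "card (nb E\<^sub>0 x) \<le> card (nb E x)" using d x by blast
    also have "\<dots> = card (nb E' x) + (if x \<in> nb E w - B then 1 else 0)" using xw by (rule c(6))
    also have "\<dots> \<le> card (nb E' x) + (if x = u then 1 else 0)"
    proof (cases "x \<in> nb E w - B")
      case True
      then have "x = u" by (rule xu)
      then show ?thesis by simp
    next
      case False
      show ?thesis unfolding if_not_P[OF False] by simp
    qed
    finally show "card (nb E\<^sub>0 x) \<le> card (nb E' x) + (if x = u then 1 else 0)" .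
  qed
qed

lemma dissolve:
  assumes "dissolving V E\<^sub>0 t C Q E ws" and "ws \<noteq> []"
    and "card Q < t" "Q \<subseteq> V" and "finite C" "200 * t - 1 \<le> card C"
    and "\<not> has_clique E\<^sub>0 V t"
  shows "\<exists>E' u. graph_on V E' \<and> routed E\<^sub>0 Q E' \<and> (\<forall>z\<in>Q. nb E' z = {}) \<and>
     (\<forall>x\<in>V - Q. card (nb E\<^sub>0 x) \<le> card (nb E' x) + (if x = u then 1 else 0))"
  using assms(1,2)
proof (induction ws arbitrary: E)
  case (Cons w ws)
  show ?case
  proof (cases "ws = []")
    case True
    then have "dissolving V E\<^sub>0 t C Q E [w]" using Cons.prems(1) by simp
    then show ?thesis using assms(3,4,7) by (rule dissolve_last)
  next
    case False
    obtain E' where "dissolving V E\<^sub>0 t C Q E' ws"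
      using dissolve_step[OF Cons.prems(1) False assms(3-7)] by (elim exE)
    then show ?thesis using False by (rule Cons.IH)
  qed
qed simp

section \<open>The induction\<close>

text \<open>Without a clique, a set \<open>Q\<close> with the exceptional vertex \<open>v\<close> in it can be removed, and what remains
satisfies the assumptions again, with at most one new exceptional vertex \<open>u\<close>. The remainder is not empty,
since \<open>Q\<close> has fewer elements than \<open>v\<close> has neighbours. A clique of the remainder avoids \<open>Q\<close>, and
so it is a clique of the whole graph.\<close>

lemma has_clique_of_degrees:
  assumes "t > 0"
  shows "graph_on V E \<Longrightarrow> v \<in> V \<Longrightarrow> 200 * t - 1 \<le> card (nb E v) \<Longrightarrow>
    (\<And>x. x \<in> V - {v} \<Longrightarrow> 200 * t \<le> card (nb E x)) \<Longrightarrow> has_clique E V t"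
proof (induction "card V" arbitrary: V E v rule: less_induct)
  case less
  note g = less.prems(1)
  have finV: "finite V" using g by (simp add: graph_on_def)
  show ?case
  proof (rule ccontr)
    assume no: "\<not> has_clique E V t"
    define C where "C = nb E v"
    have C: "C \<subseteq> V" "200 * t - 1 \<le> card C" "finite C"
      using graph_on_nb(1,2)[OF g, of v] less.prems(3) by (simp_all add: C_def)
    have big: "card (nb E v) \<le> card V" using graph_on_nb(1)[OF g] finV by (rule card_mono[rotated])
    show False
    \<comment> \<open>Collecting starts with \<open>{v}\<close>, which must have fewer than \<open>t\<close> elements.\<close>
    proof (cases "t = 1")
      case True
      have "pairs {v} = {}" by (auto simp: pairs_def card_2_iff)
      then have "has_clique E V t" using less.prems(2) True unfolding has_clique_def
        by (intro exI[of _ "{v}"] conjI) (simp_all add: routed_subset)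
      then show False using no by simp
    next
      case False
      then have v: "card {v} < t" using assms by simp
      obtain E1 Q ws where cl: "cluster V E t C E1 Q ws" and Q: "card Q < t" "set ws = Q" "{v} \<subseteq> Q"
        using cluster_closed[OF assms no g C(1,2) cluster_start[OF g less.prems(2), folded C_def] v]
        by (elim exE conjE)
      have QV: "Q \<subseteq> V" using cl by (simp add: cluster_def)
      have ws: "ws \<noteq> []" using Q by auto
      obtain E' u where g': "graph_on V E'" and rt: "routed E Q E'"
        and empty: "\<forall>z\<in>Q. nb E' z = {}"
        and deg: "\<forall>x\<in>V - Q. card (nb E x) \<le> card (nb E' x) + (if x = u then 1 else 0)"
        using dissolve[OF cluster_dissolving[OF cl Q(2,1)] ws Q(1) QV C(3,2) no] by (elim exE conjE)
      have "graph_on (V - Q) E'"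
        unfolding graph_on_def
      proof (intro conjI ballI)
        fix e assume e: "e \<in> E'"
        then show "card e = 2" using g' by (simp add: graph_on_def)
        then obtain a b where ab: "e = {a, b}" by (auto simp: card_2_iff)
        then have "b \<in> nb E' a" "a \<in> nb E' b" using e by (auto simp: nb_def insert_commute)
        then have "a \<notin> Q" "b \<notin> Q" using empty by auto
        then show "e \<subseteq> V - Q" using e ab g' by (auto simp: graph_on_def)
      qed (use finV in simp)
      moreover have degE: "200 * t \<le> card (nb E' x) + (if x = u then 1 else 0)" if "x \<in> V - Q" for x
      proof -
        have "x \<in> V - {v}" using that Q(3) by blast
        then have "200 * t \<le> card (nb E x)" by (rule less.prems(4))
        then show ?thesis using deg that le_trans by blast
      qed
      obtain v' where v': "v' \<in> V - Q" "u \<in> V - Q \<longrightarrow> v' = u"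
      proof -
        have "card Q < card V" using big less.prems(3) Q(1) by linarith
        then have "\<not> V \<subseteq> Q" using card_mono[of Q V] QV finV finite_subset by fastforce
        then show ?thesis using that by (cases "u \<in> V - Q") blast+
      qed
      moreover have "200 * t - 1 \<le> card (nb E' v')" using degE[OF v'(1)] by (simp split: if_splits)
      moreover have "200 * t \<le> card (nb E' x)" if "x \<in> V - Q - {v'}" for x
      proof -
        have "x \<noteq> u" using that v'(2) by auto
        then show ?thesis using degE[of x] that by simp
      qed
      moreover have "card (V - Q) < card V" using finV Q(3) less.prems(2) by (intro psubset_card_mono) auto
      ultimately have "has_clique E' (V - Q) t" using less.hyps[of "V - Q" E' v'] by blast
      then have "has_clique E (V - Q) t" by (rule has_clique_routed[OF rt]) auto
      then show False using no has_clique_mono by blast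
    qed
  qed
qed

lemma degree_eq_card_nb:
  assumes "simple_graph G"
  shows "degree G v = card (nb (edges G) v)"
proof -
  have "bij_betw (\<lambda>y. {v, y}) (nb (edges G) v) {e \<in> edges G. v \<in> e}"
  proof (rule bij_betwI')
    fix e assume e: "e \<in> {e \<in> edges G. v \<in> e}"
    then have "card e = 2" using assms by (simp add: simple_graph_def)
    then obtain y where "e = {v, y}" using e by (auto simp: card_2_iff)
    then show "\<exists>y\<in>nb (edges G) v. e = {v, y}" using e by (auto simp: nb_def)
  qed (auto simp: nb_def doubleton_eq_iff)
  then show ?thesis unfolding degree_def by (simp add: bij_betw_same_card)
qed

theorem theorem1p3:
  fixes G :: "'a ugraph" and t :: nat
  assumes "t > 0"
    and "simple_graph G" and "verts G \<noteq> {}"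
    and "min_degree G \<ge> 200 * t"
  shows "contains_strong_immersion G (complete_graph t)"
proof -
  have fin: "finite (verts G)" using assms(2) by (simp add: simple_graph_def)
  have deg: "200 * t \<le> card (nb (edges G) x)" if "x \<in> verts G" for x
  proof -
    have "min_degree G \<le> degree G x" using that fin by (simp add: min_degree_def)
    then show ?thesis using assms(2,4) by (simp add: degree_eq_card_nb)
  qed
  have g: "graph_on (verts G) (edges G)" using assms(2) by (simp add: graph_on_def simple_graph_def)
  obtain v where "v \<in> verts G" using assms(3) by blast
  then have "has_clique (edges G) (verts G) t"
    using deg[of v] by (intro has_clique_of_degrees[OF assms(1) g]) (auto intro: deg)
  then show ?thesis by (rule contains_complete_graph[OF assms(2)])
qed

end
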